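(* Let $\mu$ be the probability measure on the Farey group $\Gamma$ given by $\mu(\{a\})=\mu(\{b\})=\mu(\{c\})=\frac13$, and let $\mu_{\bar{\mathcal{M}}}$ be the extended Minkowski measure on $X=P(\mathbb{R}^2)$. For any probability measure $\pi$ on $X$, the following limit exists in the weak-$*$ topology: $$\lim_{n\to\infty}\mu^{*n}*\pi=\mu_{\bar{\mathcal{M}}}.$$
   Context: Action: $PSL(2,\mathbb{R})$ acts on the projective line $X=P(\mathbb{R}^2)$ through the linear action on $\mathbb{R}^2$. $X$ is identified with $\mathbb{R}\cup\{\infty\}$ by sending the class of $(x,y)^T$ to $x/y$ if $y\neq0$ and the class of $(1,0)^T$ to $\infty$; the action becomes the action by Möbius transformations. Farey group: the subgroup $\Gamma$ of $PSL(2,\mathbb{Z})$ generated by the classes of $$a=\begin{pmatrix}1&-2\\1&-1\end{pmatrix},\quad b=\begin{pmatrix}0&-1\\1&0\end{pmatrix},\quad c=\begin{pmatrix}1&-1\\2&-1\end{pmatrix}.$$ Convolution: $\mu^{*n}=\mu*\cdots*\mu$ ($n$ times) is the convolution power on $\Gamma$; for a probability measure $\mu$ on $\Gamma$ and a measure $\pi$ on $X$, $\int_X f\,d(\mu*\pi)=\int_\Gamma\int_X f(gx)\,d\pi(x)\,d\mu(g)$. Farey sequences: for rationals in lowest terms with positive denominators, $\frac{p_1}{q_1}\oplus\frac{p_2}{q_2}=\frac{p_1+p_2}{q_1+q_2}$. Set $\mathscr{F}_0=(0,1)$ (with $0=\frac01$, $1=\frac11$), and let $\mathscr{F}_{n+1}$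 be obtained from $\mathscr{F}_n$ by inserting $s\oplus t$ between every two consecutive terms $s,t$. Each $\mathscr{F}_n$ is increasing and has $2^n+1$ terms. Minkowski function: $\mathcal{M}:[0,1]\to[0,1]$ is the unique continuous function such that $\mathcal{M}(q)=k/2^n$ whenever $q$ is the $(k+1)$-th term of $\mathscr{F}_n$ (this does not depend on the choice of $n$). Extended Minkowski measure: for $n\in\mathbb{Z}$ and $q\in[n,n+1)$, with $\{q\}$ the fractional part, let $$\bar{\mathcal{M}}(q)=\frac13\left(\sum_{k=-\infty}^{n-1}\frac1{2^{|k|}}+\frac{\mathcal{M}(\{q\})}{2^{|n|}}\right).$$ Then $\mu_{\bar{\mathcal{M}}}$ is the Borel probability measure on $\mathbb{R}$ with $\mu_{\bar{\mathcal{M}}}([s,t))=\bar{\mathcal{M}}(t)-\bar{\mathcal{M}}(s)$ for $s<t$, viewed as a measure on $X=\mathbb{R}\cup\{\infty\}$ giving mass $0$ to $\infty$. *)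

theory Defs
  imports "HOL-Probability.Probability" "HOL-Algebra.Generated_Groups"
begin

section \<open>The groups\<close>

definition SL2R :: "(real^2^2) monoid" where
  "SL2R = \<lparr>carrier = {A. det A = 1}, monoid.mult = (**), one = mat 1\<rparr>"

definition PSL2R :: "((real^2^2) set) monoid" where
  "PSL2R = SL2R Mod {mat 1, - mat 1}"

definition psl_class :: "real^2^2 \<Rightarrow> (real^2^2) set" where
  "psl_class A = {mat 1, - mat 1} #>\<^bsub>SL2R\<^esub> A"

definition PSL2Z :: "((real^2^2) set) monoid" where
  "PSL2Z = PSL2R\<lparr>carrier := psl_class ` {A \<in> carrier SL2R. \<forall>i j. A $ i $ j \<in> \<int>}\<rparr>"

text \<open>Matrices are written as lists of rows.\<close>

definition farey_a :: "real^2^2" where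
  "farey_a = vector [vector [1, -2], vector [1, -1]]"

definition farey_b :: "real^2^2" where
  "farey_b = vector [vector [0, -1], vector [1, 0]]"

definition farey_c :: "real^2^2" where
  "farey_c = vector [vector [1, -1], vector [2, -1]]"

definition farey_group :: "((real^2^2) set) monoid" where
  "farey_group =
     PSL2Z\<lparr>carrier := generate PSL2Z {psl_class farey_a, psl_class farey_b, psl_class farey_c}\<rparr>"


section \<open>The projective line\<close>

typedef proj_line = "{L :: (real^2) set. subspace L \<and> dim L = 1}"
  morphisms line_set Abs_proj_line
proof -
  have "dim (span {axis 1 1 :: real^2}) = 1"
    by (simp add: dim_eq_card_independent axis_eq_0_iff)
  then show ?thesis
    using subspace_span by blast
qed

definition proj_class :: "real^2 \<Rightarrow> proj_line" where
  "proj_class v = Abs_proj_line (span {v})"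

text \<open>The quotient topology along \<^const>\<open>proj_class\<close>, which is meaningful on nonzero
  vectors only. A subset of the open set of nonzero vectors is relatively open iff it is open.\<close>

instantiation proj_line :: topological_space
begin

definition open_proj_line :: "proj_line set \<Rightarrow> bool" where
  "open_proj_line U \<longleftrightarrow> open {v. v \<noteq> 0 \<and> proj_class v \<in> U}"

instance
proof
  have "{v::real^2. v \<noteq> 0 \<and> proj_class v \<in> UNIV} = - {0}"
    by auto
  then show "open (UNIV :: proj_line set)"
    by (simp add: open_proj_line_def open_Compl)
next
  fix S T :: "proj_line set"
  assume *: "open S" "open T"
  have "{v. v \<noteq> 0 \<and> proj_class v \<in> S \<inter> T} =
        {v. v \<noteq> 0 \<and> proj_class v \<in> S} \<inter> {v. v \<noteq> 0 \<and> proj_class v \<in> T}"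
    by auto
  then show "open (S \<inter> T)"
    using * by (auto simp: open_proj_line_def)
next
  fix K :: "proj_line set set"
  assume *: "\<forall>S\<in>K. open S"
  have "{v. v \<noteq> 0 \<and> proj_class v \<in> \<Union>K} = (\<Union>S\<in>K. {v. v \<noteq> 0 \<and> proj_class v \<in> S})"
    by auto
  then show "open (\<Union>K)"
    using * by (auto simp: open_proj_line_def)
qed

end

text \<open>An element of \<^const>\<open>PSL2R\<close> is a set of two matrices \<open>A\<close> and \<open>- A\<close>, and both map a given
  line to the same line, so that the union over the representatives is just that line.\<close>

definition proj_act :: "(real^2^2) set \<Rightarrow> proj_line \<Rightarrow> proj_line" where
  "proj_act g x = Abs_proj_line (\<Union>A\<in>g. (\<lambda>v. A *v v) ` line_set x)"

definition proj_of_real :: "real \<Rightarrow> proj_line" where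
  "proj_of_real t = proj_class (vector [t, 1])"


section \<open>Convolution\<close>

text \<open>Measures on a discrete group, i.e. measures whose \<open>\<sigma>\<close>-algebra is the power set of the
  carrier; products of such measures are again of this kind if the group is countable.\<close>

definition group_convolution ::
    "('a, 'b) monoid_scheme \<Rightarrow> 'a measure \<Rightarrow> 'a measure \<Rightarrow> 'a measure" where
  "group_convolution G \<mu> \<nu> =
     distr (\<mu> \<Otimes>\<^sub>M \<nu>) (count_space (carrier G)) (\<lambda>(g, h). g \<otimes>\<^bsub>G\<^esub> h)"

primrec convolution_power ::
    "('a, 'b) monoid_scheme \<Rightarrow> 'a measure \<Rightarrow> nat \<Rightarrow> 'a measure" where
  "convolution_power G \<mu> 0 = return (count_space (carrier G)) \<one>\<^bsub>G\<^esub>"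
| "convolution_power G \<mu> (Suc n) = group_convolution G \<mu> (convolution_power G \<mu> n)"

text \<open>Pushing the product measure forward along the action means
  \<open>\<integral>f d(\<mu> * \<pi>) = \<integral>\<integral>f (g x) d\<pi>(x) d\<mu>(g)\<close> for bounded Borel functions \<open>f\<close>.\<close>

definition act_convolution ::
    "(real^2^2) set measure \<Rightarrow> proj_line measure \<Rightarrow> proj_line measure" where
  "act_convolution \<mu> \<pi> = distr (\<mu> \<Otimes>\<^sub>M \<pi>) borel (\<lambda>(g, x). proj_act g x)"


section \<open>The weak-* topology\<close>

text \<open>The weak-* topology on Borel probability measures of a compact space: the coarsest topology
  making \<open>\<mu> \<mapsto> \<integral>f d\<mu>\<close> continuous for every continuous real function \<open>f\<close>.\<close>

definition weak_star_topology :: "'a::topological_space measure topology" where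
  "weak_star_topology =
     pullback_topology {M. prob_space M \<and> sets M = sets borel}
       (\<lambda>M. \<lambda>f\<in>{f. continuous_on UNIV f}. \<integral>x. f x \<partial>M)
       (powertop_real {f. continuous_on UNIV f})"


section \<open>The Minkowski function and the extended Minkowski measure\<close>

definition mediant :: "rat \<Rightarrow> rat \<Rightarrow> rat" where
  "mediant s t = (case (quotient_of s, quotient_of t) of
     ((p1, q1), (p2, q2)) \<Rightarrow> Fract (p1 + p2) (q1 + q2))"

fun insert_mediants :: "rat list \<Rightarrow> rat list" where
  "insert_mediants (s # t # xs) = s # mediant s t # insert_mediants (t # xs)"
| "insert_mediants xs = xs"

primrec farey_seq :: "nat \<Rightarrow> rat list" where
  "farey_seq 0 = [0, 1]"
| "farey_seq (Suc n) = insert_mediants (farey_seq n)"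

text \<open>Uniqueness of a function on \<open>[0,1]\<close> requires fixing its values elsewhere, whence the
  extensional function space.\<close>

definition minkowski :: "real \<Rightarrow> real" where
  "minkowski = (THE f. f \<in> {0..1} \<rightarrow>\<^sub>E {0..1} \<and> continuous_on {0..1} f \<and>
     (\<forall>n. \<forall>k < length (farey_seq n). f (real_of_rat (farey_seq n ! k)) = real k / 2 ^ n))"

definition ext_minkowski :: "real \<Rightarrow> real" where
  "ext_minkowski q = (let n = \<lfloor>q\<rfloor> in
     1/3 * ((\<Sum>\<^sub>\<infinity>k\<in>{..n - 1}. 1 / 2 ^ nat \<bar>k\<bar>) + minkowski (frac q) / 2 ^ nat \<bar>n\<bar>))"

definition ext_minkowski_measure_real :: "real measure" where
  "ext_minkowski_measure_real = (THE M. prob_space M \<and> sets M = sets borel \<and>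
     (\<forall>s t. s < t \<longrightarrow> measure M {s..<t} = ext_minkowski t - ext_minkowski s))"

definition ext_minkowski_measure :: "proj_line measure" where
  "ext_minkowski_measure = distr ext_minkowski_measure_real borel proj_of_real"

end

theory Submission
  imports Defs
begin

text \<open>
  Let \<open>P f (x) = (f (a x) + f (b x) + f (c x)) / 3\<close>. The integral of a continuous \<open>f\<close> against the
  \<open>n\<close>-fold convolution is the integral of \<open>P\<^sup>n f\<close> against \<open>\<pi>\<close>
  (\<open>integral_act_convolution_power\<close>). The theorem follows from two facts: the oscillation of \<open>P\<^sup>n f\<close>
  over the projective line tends to \<open>0\<close>, and the extended Minkowski measure \<open>\<nu>\<close> is stationary, that
  is, \<open>P f\<close> and \<open>f\<close> have the same integral against \<open>\<nu>\<close>. For then the integrals of \<open>P\<^sup>n f\<close> against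
  \<open>\<pi>\<close> and \<open>\<nu>\<close> differ by at most that oscillation, and the second one does not depend on \<open>n\<close>.

  The geometry behind both facts is the ideal triangle with vertices \<open>0\<close>, \<open>1\<close>, \<open>\<infinity>\<close>. Its vertices cut the
  projective line into three arcs, which the map \<open>r x = 1 / (1 - x)\<close> of order three permutes
  cyclically. The involution \<open>c\<close> exchanges the arc \<open>[0, 1]\<close> with its complement, and \<open>a\<close>, \<open>b\<close> are the
  conjugates of \<open>c\<close> by \<open>r\<close>. The maps \<open>L x = x / (1 + x) = c (r x)\<close> and \<open>R x = 1 / (2 - x) = c (r (r x))\<close>
  take \<open>[0, 1]\<close> to its two halves \<open>[0, 1/2]\<close> and \<open>[1/2, 1]\<close>, and repeating this subdivision produces the
  Farey sequences. These relations say how a generator moves a point inside the nested family of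
  arcs.

  \<^item> Contraction (\<open>arc_lipschitz_walk_average\<close>). Say that two points agree to depth \<open>k\<close> if they lie in a
    common arc of level \<open>k\<close>, and measure distance by \<open>(3/4)\<^sup>k\<close>. If two points agree to depth \<open>k \<ge> 1\<close>, one
    generator lowers the depth by one and the other two raise it by one, so that the average distance
    is multiplied by \<open>(4/3 + 2 * 3/4) / 3 = 17/18\<close>. If they lie in different arcs of the first level, the
    generator belonging to the third arc moves both into that arc, and the average is at most \<open>11/12\<close>.
    Continuous functions are Lipschitz for this distance up to an arbitrarily small error, because
    the length of the Farey intervals of level \<open>k\<close> in \<open>[0, 1]\<close> is at most \<open>1 / (k + 1)\<close>.

  \<^item> Stationarity (\<open>integral_walk_average\<close>). The Minkowski function satisfies \<open>M (L x) = M x / 2\<close> and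
    \<open>M (R x) = (1 + M x) / 2\<close>. Hence the measure \<open>\<lambda>\<close> on \<open>[0, 1]\<close> with distribution function \<open>M\<close> is the mean
    of its images under \<open>L\<close> and \<open>R\<close>, and \<open>\<nu>\<close> is the mean of the images of \<open>\<lambda>\<close> under \<open>1\<close>, \<open>r\<close> and \<open>r\<^sup>2\<close>.
    Stationarity is then a computation with the relations between \<open>c\<close>, \<open>r\<close>, \<open>L\<close> and \<open>R\<close>.
\<close>

section \<open>The Minkowski function as a fixed point\<close>

text \<open>The two branches of the subdivision. They are polymorphic because they act on the rational Farey
  sequences as well as on real numbers.\<close>

definition farey_left :: "'a::field \<Rightarrow> 'a" where
  "farey_left x = x / (1 + x)"

definition farey_right :: "'a::field \<Rightarrow> 'a" where
  "farey_right x = 1 / (2 - x)"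

text \<open>Here \<open>x / (1 - x)\<close> and \<open>2 - 1 / x\<close> are the inverse maps of the two branches, so that a fixed point \<open>f\<close> of
  this operator satisfies \<open>f (farey_left x) = f x / 2\<close> and \<open>f (farey_right x) = (1 + f x) / 2\<close>.\<close>

definition self_similar_step :: "(real \<Rightarrow> real) \<Rightarrow> real \<Rightarrow> real" where
  "self_similar_step f x = (if x \<le> 1/2 then f (x / (1 - x)) / 2 else (1 + f (2 - 1 / x)) / 2)"

text \<open>Prescribing the values outside \<open>[0, 1]\<close> keeps the fixed point equation valid on the whole line and
  makes the fixed point a distribution function.\<close>

definition clamped_cdf :: "(real \<Rightarrow> real) \<Rightarrow> bool" where
  "clamped_cdf f \<longleftrightarrow> mono f \<and> (\<forall>x\<le>0. f x = 0) \<and> (\<forall>x\<ge>1. f x = 1)"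

lemma clamped_cdf_bounds:
  assumes "clamped_cdf f"
  shows "0 \<le> f x" "f x \<le> 1"
proof -
  have "mono f"
    using assms by (simp add: clamped_cdf_def)
  then have "f (min x 0) \<le> f x" "f x \<le> f (max x 1)"
    by (simp_all add: monoD)
  then show "0 \<le> f x" "f x \<le> 1"
    using assms by (auto simp: clamped_cdf_def)
qed

lemma clamped_cdf_step:
  assumes f: "clamped_cdf f"
  shows "clamped_cdf (self_similar_step f)"
proof -
  have m: "f x \<le> f y" if "x \<le> y" for x y
    using f that by (auto simp: clamped_cdf_def intro: monoD)
  have "self_similar_step f x \<le> self_similar_step f y" if "x \<le> y" for x y
  proof -
    have "x / (1 - x) \<le> y / (1 - y)" if "y \<le> 1/2"
      using \<open>x \<le> y\<close> that by (simp add: divide_simps) (simp add: algebra_simps)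
    moreover have "2 - 1 / x \<le> 2 - 1 / y" if "x > 1/2"
      using \<open>x \<le> y\<close> that by (simp add: frac_le)
    moreover have "f (x / (1 - x)) \<le> 1 + f (2 - 1 / y)"
      using clamped_cdf_bounds[OF f] by (smt (verit))
    ultimately show ?thesis
      using that m by (auto simp: self_similar_step_def)
  qed
  moreover have "self_similar_step f x = 0" if "x \<le> 0" for x
  proof -
    have "x / (1 - x) \<le> 0"
      using that by (simp add: divide_simps)
    then show ?thesis
      using f that by (simp add: clamped_cdf_def self_similar_step_def)
  qed
  moreover have "self_similar_step f x = 1" if "x \<ge> 1" for x
  proof -
    have "2 - 1 / x \<ge> 1"
      using that by (simp add: divide_simps)
    then show ?thesis
      using f that by (simp add: clamped_cdf_def self_similar_step_def)
  qed
  ultimately show ?thesis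
    by (auto simp: clamped_cdf_def intro: monoI)
qed

lemma continuous_step:
  assumes f: "clamped_cdf f" and cont: "continuous_on UNIV f"
  shows "continuous_on UNIV (self_similar_step f)"
proof -
  have *: "continuous_on A (\<lambda>x. f (g x))" if "continuous_on A g" for A and g :: "real \<Rightarrow> real"
    using continuous_on_compose2[OF cont that] by simp
  have "continuous_on ({..1/2} \<union> {1/2..}) (self_similar_step f)"
    unfolding self_similar_step_def
  proof (rule continuous_on_If)
    show "continuous_on {..1/2} (\<lambda>x. f (x / (1 - x)) / 2)"
      by (intro continuous_intros *) auto
    show "continuous_on {1/2..} (\<lambda>x. (1 + f (2 - 1 / x)) / 2)"
      by (intro continuous_intros *) auto
    have "f 1 = 1" "f 0 = 0"
      using f by (auto simp: clamped_cdf_def)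
    then show "f (x / (1 - x)) / 2 = (1 + f (2 - 1 / x)) / 2" if "x \<in> {1/2..}" "x \<le> 1/2" for x
    proof -
      have x: "x = 1/2"
        using that by simp
      show ?thesis
        unfolding x using \<open>f 1 = 1\<close> \<open>f 0 = 0\<close> by simp
    qed
    show "f (x / (1 - x)) / 2 = (1 + f (2 - 1 / x)) / 2" if "x \<in> {..1/2}" "\<not> x \<le> 1/2" for x
      using that by auto
  qed auto
  moreover have "{..1/2} \<union> {1/2..} = (UNIV :: real set)"
    by auto
  ultimately show ?thesis
    by simp
qed

text \<open>The operator halves the distance in the supremum norm and preserves the closed set of continuous
  functions with the above normalization, so the Banach fixed point theorem applies.\<close>

lemma ex_self_similar_cdf:
  "\<exists>f. clamped_cdf f \<and> continuous_on UNIV f \<and> self_similar_step f = f"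
proof -
  define S where "S = {f :: real \<Rightarrow>\<^sub>C real. clamped_cdf (apply_bcontfun f)}"
  define T where "T = (\<lambda>f :: real \<Rightarrow>\<^sub>C real. Bcontfun (self_similar_step (apply_bcontfun f)))"
  have T: "apply_bcontfun (T f) = self_similar_step (apply_bcontfun f)" if "f \<in> S" for f
    unfolding T_def
  proof (rule Bcontfun_inverse, rule bcontfun_normI)
    have f: "clamped_cdf (apply_bcontfun f)"
      using that by (simp add: S_def)
    show "continuous_on UNIV (self_similar_step (apply_bcontfun f))"
      using f by (rule continuous_step) simp
    show "norm (self_similar_step (apply_bcontfun f) x) \<le> 1" for x
      using clamped_cdf_bounds[OF clamped_cdf_step[OF f]] by simp
  qed
  have cont: "continuous_on UNIV (\<lambda>f :: real \<Rightarrow>\<^sub>C real. apply_bcontfun f x)" for x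
    by (rule lipschitz_on_continuous_on[of 1], rule lipschitz_onI) (simp_all add: dist_bounded)
  have "closed S"
    unfolding S_def clamped_cdf_def mono_def
    by (intro closed_Collect_conj closed_Collect_all closed_Collect_imp closed_Collect_le
        closed_Collect_eq cont continuous_on_const open_Collect_const)
  note complete_eq_closed[THEN iffD2, OF this]
  moreover have "S \<noteq> {}"
  proof -
    have "(\<lambda>x::real. max 0 (min 1 x)) \<in> bcontfun"
      by (rule bcontfun_normI[where b = 1]) (auto intro!: continuous_intros)
    then have "Bcontfun (\<lambda>x. max 0 (min 1 x)) \<in> S"
      by (auto simp: S_def Bcontfun_inverse clamped_cdf_def mono_def)
    then show ?thesis
      by blast
  qed
  moreover have "T ` S \<subseteq> S"
    using T clamped_cdf_step by (auto simp: S_def)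
  moreover have "\<forall>f\<in>S. \<forall>g\<in>S. dist (T f) (T g) \<le> 1/2 * dist f g"
  proof (intro ballI dist_bound)
    fix f g x
    assume "f \<in> S" "g \<in> S"
    have "\<bar>apply_bcontfun f y - apply_bcontfun g y\<bar> \<le> dist f g" for y
      using dist_bounded[of f y g] by (simp add: dist_real_def)
    from this[of "if x \<le> 1/2 then x / (1 - x) else 2 - 1 / x"]
    show "dist (apply_bcontfun (T f) x) (apply_bcontfun (T g) x) \<le> 1/2 * dist f g"
      using \<open>f \<in> S\<close> \<open>g \<in> S\<close>
      by (simp add: T self_similar_step_def dist_real_def flip: diff_divide_distrib split: if_splits)
  qed
  ultimately obtain f where "f \<in> S" "T f = f"
    using Banach_fix[of S "1/2" T] by auto
  then show ?thesis
    using T[of f] by (intro exI[of _ "apply_bcontfun f"]) (auto simp: S_def)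
qed

definition question_mark :: "real \<Rightarrow> real" where
  "question_mark = (SOME f. clamped_cdf f \<and> continuous_on UNIV f \<and> self_similar_step f = f)"

lemma question_mark_cdf: "clamped_cdf question_mark"
  and question_mark_continuous: "continuous_on UNIV question_mark"
  and question_mark_step: "self_similar_step question_mark = question_mark"
  using someI_ex[OF ex_self_similar_cdf] unfolding question_mark_def by blast+

lemmas question_mark_bounds = clamped_cdf_bounds[OF question_mark_cdf]

lemma question_mark_outside [simp]:
  "x \<le> 0 \<Longrightarrow> question_mark x = 0" "x \<ge> 1 \<Longrightarrow> question_mark x = 1"
  using question_mark_cdf by (auto simp: clamped_cdf_def)

lemma question_mark_mono: "x \<le> y \<Longrightarrow> question_mark x \<le> question_mark y"
  using question_mark_cdf by (auto simp: clamped_cdf_def intro: monoD)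

lemma question_mark_lower: "x \<le> 1/2 \<Longrightarrow> question_mark x = question_mark (x / (1 - x)) / 2"
  using fun_cong[OF question_mark_step, of x] by (simp add: self_similar_step_def)

lemma question_mark_upper: "x \<ge> 1/2 \<Longrightarrow> question_mark x = (1 + question_mark (2 - 1 / x)) / 2"
proof (cases "x = 1/2")
  case True
  show ?thesis
    unfolding True using question_mark_lower[of "1/2"] by simp
qed (use fun_cong[OF question_mark_step, of x] in \<open>simp add: self_similar_step_def\<close>)

lemma question_mark_left:
  assumes "0 \<le> x" "x \<le> 1"
  shows "question_mark (farey_left x) = question_mark x / 2"
proof -
  have "farey_left x \<le> 1/2" "farey_left x / (1 - farey_left x) = x"
    using assms by (simp_all add: farey_left_def field_simps)
  then show ?thesis
    using question_mark_lower[of "farey_left x"] by simp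
qed

lemma question_mark_right:
  assumes "0 \<le> x" "x \<le> 1"
  shows "question_mark (farey_right x) = (1 + question_mark x) / 2"
proof -
  have "farey_right x \<ge> 1/2" "2 - 1 / farey_right x = x"
    using assms by (simp_all add: farey_right_def field_simps)
  then show ?thesis
    using question_mark_upper[of "farey_right x"] by simp
qed

section \<open>Farey intervals\<close>

lemma farey_left_range: "0 \<le> x \<Longrightarrow> x \<le> 1 \<Longrightarrow> 0 \<le> farey_left x \<and> farey_left x \<le> (1/2 :: 'a::linordered_field)"
  by (auto simp: farey_left_def field_simps)

lemma farey_right_range: "0 \<le> x \<Longrightarrow> x \<le> 1 \<Longrightarrow> (1/2 :: 'a::linordered_field) \<le> farey_right x \<and> farey_right x \<le> 1"
  by (auto simp: farey_right_def field_simps)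

lemma farey_cases:
  fixes x :: real
  assumes "0 \<le> x" "x \<le> 1"
  obtains y where "0 \<le> y" "y \<le> 1" "x = farey_left y \<and> x \<le> 1/2 \<or> x = farey_right y \<and> x \<ge> 1/2"
proof (cases "x \<le> 1/2")
  case True
  with assms show ?thesis
    by (intro that[of "x / (1 - x)"]) (auto simp: farey_left_def field_simps)
next
  case False
  with assms show ?thesis
    by (intro that[of "2 - 1 / x"]) (auto simp: farey_right_def field_simps)
qed

text \<open>The intervals of level \<open>k + 1\<close> are the images of those of level \<open>k\<close> under the two branches. The
  relation says that two points lie in the same interval of level \<open>k\<close>. The intervals are closed,
  so that a common end point belongs to both neighbours.\<close>

inductive same_farey_interval :: "nat \<Rightarrow> real \<Rightarrow> real \<Rightarrow> bool" where
  unit: "\<lbrakk>0 \<le> t; t \<le> 1; 0 \<le> s; s \<le> 1\<rbrakk> \<Longrightarrow> same_farey_interval 0 t s"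
| left: "same_farey_interval k t s \<Longrightarrow> same_farey_interval (Suc k) (farey_left t) (farey_left s)"
| right: "same_farey_interval k t s \<Longrightarrow> same_farey_interval (Suc k) (farey_right t) (farey_right s)"

lemma same_farey_interval_range:
  assumes "same_farey_interval k t s"
  shows "0 \<le> t \<and> t \<le> 1 \<and> 0 \<le> s \<and> s \<le> 1"
  using assms
proof induction
  case (left k t s)
  then show ?case using farey_left_range[of t] farey_left_range[of s] by simp
next
  case (right k t s)
  then show ?case using farey_right_range[of t] farey_right_range[of s] by simp
qed simp

text \<open>The Farey interval with end points \<open>p / q\<close> and \<open>p' / q'\<close> is the image of \<open>[0, 1]\<close> under a Moebius map of
  determinant one with denominator \<open>q * (1 - x) + q' * x\<close>. Images of \<open>t\<close> and \<open>s\<close> under that map have distance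
  \<open>\<bar>t - s\<bar>\<close> divided by the two values of the denominator, and the lemma bounds this by
  \<open>1 / (k + q + q' - 1)\<close>. Composing with a branch from inside replaces the pair \<open>(q, q')\<close> by
  \<open>(q, q + q')\<close> or \<open>(q + q', q')\<close>, which increases \<open>q + q'\<close> by at least one; hence the induction with
  arbitrary weights.\<close>

lemma weighted_farey_interval_length:
  assumes "same_farey_interval k t s" and "q \<ge> 1" "q' \<ge> 1"
  shows "(real k + q + q' - 1) * \<bar>t - s\<bar> \<le> (q * (1 - t) + q' * t) * (q * (1 - s) + q' * s)"
  using assms
proof (induction arbitrary: q q')
  case (unit t s)
  have *: "q * q' * (t - s) \<le> (q * (1 - t) + q' * t) * (q * (1 - s) + q' * s)"
    if "0 \<le> t" "t \<le> 1" "0 \<le> s" "s \<le> 1" for t s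
  proof (cases "s \<le> t")
    case True
    have "q * q' * (t - s) \<le> (q' * t) * (q * (1 - s))"
      using unit that by (simp add: algebra_simps mult_left_le)
    also have "\<dots> \<le> (q * (1 - t) + q' * t) * (q * (1 - s) + q' * s)"
      using unit that by (intro mult_mono) auto
    finally show ?thesis .
  next
    case False
    then have "q * q' * (t - s) \<le> 0"
      using unit by (simp add: mult_nonneg_nonpos)
    also have "\<dots> \<le> (q * (1 - t) + q' * t) * (q * (1 - s) + q' * s)"
      using unit that by simp
    finally show ?thesis .
  qed
  \<comment> \<open>For \<open>k = 0\<close> the claim needs \<open>q + q' - 1 \<le> q * q'\<close>.\<close>
  have "0 \<le> (q - 1) * (q' - 1)"
    using unit by simp
  then have "q + q' - 1 \<le> q * q'"
    by (simp add: algebra_simps)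
  then have "(q + q' - 1) * \<bar>t - s\<bar> \<le> q * q' * \<bar>t - s\<bar>"
    by (rule mult_right_mono) simp
  also have "\<dots> \<le> (q * (1 - t) + q' * t) * (q * (1 - s) + q' * s)"
    using *[of t s] *[of s t] unit by (cases "s \<le> t") (simp_all add: mult.commute)
  finally show ?case
    by simp
next
  case (left k t s)
  have r: "0 \<le> t" "0 \<le> s"
    using same_farey_interval_range[OF left.hyps] by auto
  have "(real (Suc k) + q + q' - 1) * \<bar>t - s\<bar> \<le> (real k + q + (q + q') - 1) * \<bar>t - s\<bar>"
    using left.prems by (intro mult_right_mono) auto
  also have "\<dots> \<le> (q * (1 - t) + (q + q') * t) * (q * (1 - s) + (q + q') * s)"
    using left.prems by (intro left.IH) auto
  finally have *: "(real (Suc k) + q + q' - 1) * \<bar>t - s\<bar> / ((1 + t) * (1 + s)) \<le>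
      (q * (1 - t) + (q + q') * t) * (q * (1 - s) + (q + q') * s) / ((1 + t) * (1 + s))"
    using r by (intro divide_right_mono) auto
  have "farey_left t - farey_left s = (t - s) / ((1 + t) * (1 + s))"
    using r by (simp add: farey_left_def field_simps)
  then have "\<bar>farey_left t - farey_left s\<bar> = \<bar>t - s\<bar> / ((1 + t) * (1 + s))"
    using r by (simp add: abs_mult)
  moreover have "q * (1 - farey_left x) + q' * farey_left x = (q * (1 - x) + (q + q') * x) / (1 + x)"
    if "0 \<le> x" for x
    using that by (simp add: farey_left_def divide_simps) (simp add: algebra_simps)
  ultimately show ?case
    using * r by simp
next
  case (right k t s)
  have r: "t \<le> 1" "s \<le> 1"
    using same_farey_interval_range[OF right.hyps] by auto
  have "(real (Suc k) + q + q' - 1) * \<bar>t - s\<bar> \<le> (real k + (q + q') + q' - 1) * \<bar>t - s\<bar>"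
    using right.prems by (intro mult_right_mono) auto
  also have "\<dots> \<le> ((q + q') * (1 - t) + q' * t) * ((q + q') * (1 - s) + q' * s)"
    using right.prems by (intro right.IH) auto
  finally have *: "(real (Suc k) + q + q' - 1) * \<bar>t - s\<bar> / ((2 - t) * (2 - s)) \<le>
      ((q + q') * (1 - t) + q' * t) * ((q + q') * (1 - s) + q' * s) / ((2 - t) * (2 - s))"
    using r by (intro divide_right_mono) auto
  have "farey_right t - farey_right s = (t - s) / ((2 - t) * (2 - s))"
    using r by (simp add: farey_right_def field_simps)
  then have "\<bar>farey_right t - farey_right s\<bar> = \<bar>t - s\<bar> / ((2 - t) * (2 - s))"
    using r by (simp add: abs_mult)
  moreover have "q * (1 - farey_right x) + q' * farey_right x = ((q + q') * (1 - x) + q' * x) / (2 - x)"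
    if "x \<le> 1" for x
    using that by (simp add: farey_right_def divide_simps) (simp add: algebra_simps)
  ultimately show ?case
    using * r by simp
qed

lemma farey_interval_length:
  assumes "same_farey_interval k t s"
  shows "\<bar>t - s\<bar> \<le> 1 / (real k + 1)"
  using weighted_farey_interval_length[OF assms, of 1 1] by (simp add: field_simps)

section \<open>Farey sequences\<close>

lemma rat_Fract:
  fixes s :: rat
  obtains p q where "quotient_of s = (p, q)" "q > 0" "coprime p q" "s = Fract p q"
  by (metis Fract_of_int_quotient quotient_of_coprime quotient_of_denom_pos quotient_of_div surj_pair)

lemma quotient_of_coprime_Fract: "0 < q \<Longrightarrow> coprime p q \<Longrightarrow> quotient_of (Fract p q) = (p, q)"
  by (simp add: quotient_of_Fract)

lemma coprime_sum: "coprime p q \<Longrightarrow> coprime p (p + q)" for p q :: int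
  by (simp add: coprime_iff_gcd_eq_1)

lemma coprime_complement: "coprime p q \<Longrightarrow> coprime q (q - p)" for p q :: int
  by (metis coprime_commute coprime_iff_gcd_eq_1 gcd_diff2)

lemma farey_left_Fract: "0 \<le> p \<Longrightarrow> 0 < q \<Longrightarrow> farey_left (Fract p q) = Fract p (p + q)"
  by (simp add: farey_left_def Fract_of_int_quotient divide_simps)

lemma farey_right_Fract: "p \<le> q \<Longrightarrow> 0 < q \<Longrightarrow> farey_right (Fract p q) = Fract q (q + (q - p))"
  by (simp add: farey_right_def Fract_of_int_quotient divide_simps)

text \<open>A branch acts linearly on the pair of numerator and denominator and keeps it in lowest terms;
  therefore it commutes with mediants, which add such pairs.\<close>

lemma mediant_left:
  assumes "0 \<le> s" "s \<le> 1" "0 \<le> t" "t \<le> 1"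
  shows "mediant (farey_left s) (farey_left t) = farey_left (mediant s t)"
proof -
  obtain p q where s: "quotient_of s = (p, q)" "q > 0" "coprime p q" "s = Fract p q"
    by (rule rat_Fract)
  obtain p' q' where t: "quotient_of t = (p', q')" "q' > 0" "coprime p' q'" "t = Fract p' q'"
    by (rule rat_Fract)
  have p: "0 \<le> p" "0 \<le> p'"
    using assms s t by (auto simp: zero_le_Fract_iff)
  have "quotient_of (farey_left s) = (p, p + q)" "quotient_of (farey_left t) = (p', p' + q')"
    using p s(2,3) t(2,3) unfolding s(4) t(4)
    by (simp_all add: farey_left_Fract quotient_of_coprime_Fract coprime_sum)
  then have "mediant (farey_left s) (farey_left t) = Fract (p + p') (p + q + (p' + q'))"
    by (simp only: mediant_def split)
  moreover have "mediant s t = Fract (p + p') (q + q')"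
    using s(1) t(1) by (simp only: mediant_def split)
  ultimately show ?thesis
    using p s(2) t(2) by (simp add: farey_left_Fract algebra_simps)
qed

lemma mediant_right:
  assumes "0 \<le> s" "s \<le> 1" "0 \<le> t" "t \<le> 1"
  shows "mediant (farey_right s) (farey_right t) = farey_right (mediant s t)"
proof -
  obtain p q where s: "quotient_of s = (p, q)" "q > 0" "coprime p q" "s = Fract p q"
    by (rule rat_Fract)
  obtain p' q' where t: "quotient_of t = (p', q')" "q' > 0" "coprime p' q'" "t = Fract p' q'"
    by (rule rat_Fract)
  have p: "p \<le> q" "p' \<le> q'"
    using assms s t by (auto simp: Fract_le_one_iff)
  have "coprime q (q + (q - p))" "coprime q' (q' + (q' - p'))"
    using s(3) t(3) by (intro coprime_sum coprime_complement; simp)+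
  then have "quotient_of (farey_right s) = (q, q + (q - p))"
      "quotient_of (farey_right t) = (q', q' + (q' - p'))"
    using p s(2) t(2) unfolding s(4) t(4)
    by (simp_all add: farey_right_Fract quotient_of_coprime_Fract)
  then have "mediant (farey_right s) (farey_right t) = Fract (q + q') (q + (q - p) + (q' + (q' - p')))"
    by (simp only: mediant_def split)
  moreover have "mediant s t = Fract (p + p') (q + q')"
    using s(1) t(1) by (simp only: mediant_def split)
  ultimately show ?thesis
    using p s(2) t(2) by (simp add: farey_right_Fract algebra_simps)
qed

lemma mediant_range:
  assumes "0 \<le> s" "s \<le> 1" "0 \<le> t" "t \<le> 1"
  shows "0 \<le> mediant s t \<and> mediant s t \<le> 1"
proof -
  obtain p q where s: "quotient_of s = (p, q)" "q > 0" "coprime p q" "s = Fract p q"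
    by (rule rat_Fract)
  obtain p' q' where t: "quotient_of t = (p', q')" "q' > 0" "coprime p' q'" "t = Fract p' q'"
    by (rule rat_Fract)
  have "0 \<le> p" "0 \<le> p'" "p \<le> q" "p' \<le> q'"
    using assms s t by (auto simp: zero_le_Fract_iff Fract_le_one_iff)
  then show ?thesis
    using s t by (simp add: mediant_def zero_le_Fract_iff Fract_le_one_iff)
qed

lemma insert_mediants_range:
  "\<forall>x\<in>set xs. 0 \<le> x \<and> x \<le> 1 \<Longrightarrow> x \<in> set (insert_mediants xs) \<Longrightarrow> 0 \<le> x \<and> x \<le> 1"
  by (induction xs rule: insert_mediants.induct) (auto simp: mediant_range)

lemma farey_seq_range: "x \<in> set (farey_seq n) \<Longrightarrow> 0 \<le> x \<and> x \<le> 1"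
proof (induction n arbitrary: x)
  case (Suc n)
  then show ?case
    using insert_mediants_range[of "farey_seq n" x] by simp
qed auto

lemma insert_mediants_map:
  assumes "\<And>s t. \<lbrakk>0 \<le> s; s \<le> 1; 0 \<le> t; t \<le> 1\<rbrakk> \<Longrightarrow> mediant (h s) (h t) = h (mediant s t)"
  shows "\<forall>x\<in>set xs. 0 \<le> x \<and> x \<le> 1 \<Longrightarrow> insert_mediants (map h xs) = map h (insert_mediants xs)"
  by (induction xs rule: insert_mediants.induct) (auto simp: assms)

lemma insert_mediants_Cons: "\<exists>us. insert_mediants (x # xs) = x # us"
  by (cases xs) auto

lemma insert_mediants_snoc: "\<exists>us. insert_mediants (xs @ [x]) = us @ [x]"
proof (induction xs rule: insert_mediants.induct)
  case (1 s t xs)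
  then obtain us where "insert_mediants ((t # xs) @ [x]) = us @ [x]"
    by blast
  then show ?case
    by (intro exI[of _ "s # mediant s t # us"]) simp
qed auto

text \<open>A mediant depends on two neighbours only, so a list can be cut at any entry \<open>y\<close>.\<close>

lemma insert_mediants_append:
  "insert_mediants (xs @ y # ys) = insert_mediants (xs @ [y]) @ tl (insert_mediants (y # ys))"
proof (induction xs rule: insert_mediants.induct)
  case ("2_1")
  obtain us where "insert_mediants (y # ys) = y # us"
    using insert_mediants_Cons by blast
  then show ?case
    by simp
next
  case ("2_2" x)
  obtain us where "insert_mediants (y # ys) = y # us"
    using insert_mediants_Cons by blast
  then show ?case
    by simp
qed auto

lemma farey_seq_shape: "\<exists>ys zs. farey_seq n = 0 # zs \<and> farey_seq n = ys @ [1]"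
proof (induction n)
  case (Suc n)
  then obtain ys zs where *: "farey_seq n = 0 # zs" "farey_seq n = ys @ [1]"
    by blast
  then show ?case
    using insert_mediants_Cons[of 0 zs] insert_mediants_snoc[of ys 1] by auto
qed simp

text \<open>The recursion in the definition refines every interval of a Farey sequence. The present recursion
  goes the other way: it glues two scaled copies of the previous sequence at \<open>1/2\<close>, and therefore
  fits the functional equations of the Minkowski function.\<close>

lemma farey_seq_Suc:
  "farey_seq (Suc n) = map farey_left (farey_seq n) @ tl (map farey_right (farey_seq n))"
proof (induction n)
  case 0
  have "mediant 0 1 = 1/2"
    by (simp add: mediant_def Fract_of_int_quotient)
  then show ?case
    by (simp add: farey_left_def farey_right_def)
next
  case (Suc n)
  obtain ys zs where *: "farey_seq n = 0 # zs" "farey_seq n = ys @ [1]"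
    using farey_seq_shape by blast
  \<comment> \<open>The two copies share the entry \<open>1/2\<close>, at which the list is cut.\<close>
  have m: "farey_left (1::rat) = farey_right 0"
    by (simp add: farey_left_def farey_right_def)
  have r: "\<forall>x\<in>set (farey_seq n). 0 \<le> x \<and> x \<le> 1"
    using farey_seq_range by blast
  have "map farey_left (farey_seq n) = map farey_left ys @ [farey_right 0]"
    by (simp only: *(2) map_append list.map m)
  moreover have "map farey_right (farey_seq n) = farey_right 0 # map farey_right zs"
    by (simp only: *(1) list.map)
  ultimately have "insert_mediants (farey_seq (Suc n)) =
      insert_mediants (map farey_left (farey_seq n)) @ tl (insert_mediants (map farey_right (farey_seq n)))"
    unfolding Suc.IH using insert_mediants_append[of "map farey_left ys" "farey_right 0" "map farey_right zs"]
    by simp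
  also have "\<dots> = map farey_left (farey_seq (Suc n)) @ tl (map farey_right (farey_seq (Suc n)))"
    using r by (simp add: insert_mediants_map mediant_left mediant_right)
  finally show ?case
    by simp
qed

lemma length_farey_seq: "length (farey_seq n) = 2 ^ n + 1"
proof (induction n)
  case (Suc n)
  then show ?case
    by (subst farey_seq_Suc) simp
qed simp

lemma question_mark_farey_seq:
  "k \<le> 2 ^ n \<Longrightarrow> question_mark (of_rat (farey_seq n ! k)) = real k / 2 ^ n"
proof (induction n arbitrary: k)
  case 0
  then have "k = 0 \<or> k = 1" by auto
  then show ?case by auto
next
  case (Suc n)
  have of_rat: "real_of_rat (farey_left x) = farey_left (of_rat x)"
     "real_of_rat (farey_right x) = farey_right (of_rat x)" for x
    by (simp_all add: farey_left_def farey_right_def of_rat_divide of_rat_add of_rat_diff)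
  have r: "0 \<le> real_of_rat (farey_seq n ! j) \<and> real_of_rat (farey_seq n ! j) \<le> 1" if "j \<le> 2 ^ n" for j
    using farey_seq_range[of "farey_seq n ! j" n] that length_farey_seq[of n] by simp
  show ?case
  proof (cases "k \<le> 2 ^ n")
    case True
    then have "farey_seq (Suc n) ! k = farey_left (farey_seq n ! k)"
      by (subst farey_seq_Suc) (simp add: nth_append length_farey_seq)
    then show ?thesis
      using Suc.IH[OF True] r[OF True] by (simp add: of_rat question_mark_left)
  next
    case False
    define j where "j = k - 2 ^ n"
    have j: "k = j + 2 ^ n" "0 < j" "j \<le> 2 ^ n"
      using False Suc.prems by (auto simp: j_def)
    have "farey_seq (Suc n) ! k = farey_right (farey_seq n ! j)"
      using j by (subst farey_seq_Suc) (simp add: nth_append length_farey_seq nth_tl)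
    then show ?thesis
      using Suc.IH[OF j(3)] r[OF j(3)] j by (simp add: of_rat question_mark_right field_simps)
  qed
qed

lemma farey_seq_approx:
  "0 \<le> t \<Longrightarrow> t \<le> 1 \<Longrightarrow> \<exists>s\<in>set (farey_seq n). same_farey_interval n t (of_rat s)"
proof (induction n arbitrary: t)
  case 0
  then show ?case by (auto intro: same_farey_interval.unit)
next
  case (Suc n)
  from Suc.prems obtain u where u: "0 \<le> u" "u \<le> 1" "t = farey_left u \<or> t = farey_right u"
    by (rule farey_cases) auto
  obtain s where s: "s \<in> set (farey_seq n)" "same_farey_interval n u (of_rat s)"
    using Suc.IH[OF u(1,2)] by blast
  obtain ys zs where *: "farey_seq n = 0 # zs" "farey_seq n = ys @ [1]"
    using farey_seq_shape by blast
  have "farey_left s \<in> set (farey_seq (Suc n))"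
    using s by (subst farey_seq_Suc) simp
  moreover have "farey_right s \<in> set (farey_seq (Suc n))"
  proof (cases "s = 0")
    case True
    \<comment> \<open>The entry \<open>1/2\<close> is dropped from the second copy, but it is the last entry of the first.\<close>
    then have "farey_right s = farey_left 1"
      by (simp add: farey_left_def farey_right_def)
    then show ?thesis
      by (subst farey_seq_Suc) (simp add: *(2))
  next
    case False
    then show ?thesis
      using s by (subst farey_seq_Suc) (simp add: *(1))
  qed
  moreover have "same_farey_interval (Suc n) (farey_left u) (of_rat (farey_left s))"
      "same_farey_interval (Suc n) (farey_right u) (of_rat (farey_right s))"
    using same_farey_interval.left[OF s(2)] same_farey_interval.right[OF s(2)]
    by (simp_all add: farey_left_def farey_right_def of_rat_divide of_rat_add of_rat_diff)
  ultimately show ?case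
    using u(3) by blast
qed

text \<open>The fixed point has the prescribed values on the Farey sequences, whose entries are dense in
  \<open>[0, 1]\<close> because the lengths of the Farey intervals tend to \<open>0\<close>; two continuous functions with these
  values agree.\<close>

lemma minkowski_eq: "minkowski = restrict question_mark {0..1}"
  unfolding minkowski_def
proof (rule the_equality)
  show "restrict question_mark {0..1} \<in> {0..1} \<rightarrow>\<^sub>E {0..1} \<and>
      continuous_on {0..1} (restrict question_mark {0..1}) \<and>
      (\<forall>n. \<forall>k<length (farey_seq n).
        restrict question_mark {0..1} (real_of_rat (farey_seq n ! k)) = real k / 2 ^ n)"
  proof (intro conjI allI impI)
    show "continuous_on {0..1} (restrict question_mark {0..1})"
      using continuous_on_subset[OF question_mark_continuous, of "{0..1}"]
      by (rule continuous_on_eq) auto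
  next
    fix n k assume "k < length (farey_seq n)"
    then show "restrict question_mark {0..1} (real_of_rat (farey_seq n ! k)) = real k / 2 ^ n"
      using farey_seq_range[of "farey_seq n ! k" n] question_mark_farey_seq[of k n]
      by (simp add: length_farey_seq)
  qed (use question_mark_bounds in auto)
next
  fix f :: "real \<Rightarrow> real"
  assume f: "f \<in> {0..1} \<rightarrow>\<^sub>E {0..1} \<and> continuous_on {0..1} f \<and>
      (\<forall>n. \<forall>k<length (farey_seq n). f (real_of_rat (farey_seq n ! k)) = real k / 2 ^ n)"
  define D where "D = (\<Union>n. real_of_rat ` set (farey_seq n))"
  have D: "D \<subseteq> {0..1}"
    using farey_seq_range by (auto simp: D_def)
  have "f x = question_mark x" if "x \<in> {0..1}" for x
  proof -
    have "x \<in> closure D"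
      unfolding closure_approachable
    proof (intro allI impI)
      fix e :: real assume "e > 0"
      then obtain n :: nat where n: "1 / (real n + 1) < e"
        using reals_Archimedean[of e] by (auto simp: inverse_eq_divide add.commute)
      obtain s where s: "s \<in> set (farey_seq n)" "same_farey_interval n x (of_rat s)"
        using farey_seq_approx \<open>x \<in> {0..1}\<close> by auto
      then show "\<exists>y\<in>D. dist y x < e"
        using farey_interval_length[OF s(2)] n
        by (intro bexI[of _ "of_rat s"]) (auto simp: D_def dist_real_def)
    qed
    then obtain u where u: "\<And>n. u n \<in> D" "u \<longlonglongrightarrow> x"
      by (auto simp: closure_sequential)
    have "(\<lambda>n. f (u n)) \<longlonglongrightarrow> f x"
      using f u(2) subsetD[OF D u(1)] that
      by (intro continuous_on_tendsto_compose[of "{0..1}" f]) (auto intro!: always_eventually)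
    moreover have "(\<lambda>n. question_mark (u n)) \<longlonglongrightarrow> question_mark x"
      using u by (intro continuous_on_tendsto_compose[OF question_mark_continuous]) auto
    moreover have "f (u n) = question_mark (u n)" for n
    proof -
      obtain m s where "u n = of_rat s" "s \<in> set (farey_seq m)"
        using u(1)[of n] by (auto simp: D_def)
      then obtain k where "k < length (farey_seq m)" "u n = of_rat (farey_seq m ! k)"
        by (auto simp: in_set_conv_nth)
      then show ?thesis
        using f question_mark_farey_seq[of k m] by (simp add: length_farey_seq)
    qed
    ultimately show ?thesis
      by (simp add: LIMSEQ_unique)
  qed
  then show "f = restrict question_mark {0..1}"
    using f by (intro extensionalityI[of f "{0..1}"]) (auto simp: PiE_def)
qed


section \<open>The extended Minkowski function\<close>

text \<open>The series in the definition of the extended Minkowski function is geometric on the negative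
  integers; for positive upper limits finitely many terms are added.\<close>

lemma sum_below_nonpos:
  "((\<lambda>k. 1 / 2 ^ nat \<bar>k\<bar>) has_sum (1 / 2 ^ n :: real)) {..- int n - 1}"
proof -
  have "(\<lambda>j. 1 / 2 ^ (n + 1) * (1 / 2) ^ j :: real) sums (1 / 2 ^ (n + 1) * (1 / (1 - 1 / 2)))"
    by (intro sums_mult geometric_sums) simp
  then have "((\<lambda>j. 1 / 2 ^ (n + 1) * (1 / 2) ^ j :: real) has_sum (1 / 2 ^ n)) UNIV"
    by (intro sums_nonneg_imp_has_sum) simp_all
  then show ?thesis
  proof (rule has_sum_reindex_bij_witness[THEN iffD1, rotated -1])
    show "- int n - 1 - int (nat (- int n - 1 - k)) = k" if "k \<in> {..- int n - 1}" for k
      using that by simp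
    show "1 / 2 ^ nat \<bar>- int n - 1 - int j\<bar> = (1 / 2 ^ (n + 1) * (1 / 2) ^ j :: real)" for j
    proof -
      have "nat \<bar>- int n - 1 - int j\<bar> = n + 1 + j"
        by simp
      then show ?thesis
        by (simp add: power_add power_divide)
    qed
  qed auto
qed

lemma sum_below_nonneg:
  "((\<lambda>k. 1 / 2 ^ nat \<bar>k\<bar>) has_sum (3 - 2 / 2 ^ n :: real)) {..int n - 1}"
proof (induction n)
  case 0
  then show ?case
    using sum_below_nonpos[of 0] by simp
next
  case (Suc n)
  have "((\<lambda>k. 1 / 2 ^ nat \<bar>k\<bar>) has_sum (1 / 2 ^ n :: real)) {int n}"
    using has_sum_finite[of "{int n}" "\<lambda>k. 1 / 2 ^ nat \<bar>k\<bar> :: real"] by simp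
  from has_sum_Un_disjoint[OF Suc.IH this]
  have "((\<lambda>k. 1 / 2 ^ nat \<bar>k\<bar>) has_sum (3 - 2 / 2 ^ n + 1 / 2 ^ n :: real)) ({..int n - 1} \<union> {int n})"
    by simp
  moreover have "{..int n - 1} \<union> {int n} = {..int (Suc n) - 1}"
    by auto
  moreover have "3 - 2 / 2 ^ n + 1 / 2 ^ n = (3 - 2 / 2 ^ Suc n :: real)"
    by (simp add: field_simps)
  ultimately show ?case
    by metis
qed

text \<open>A unit step of \<open>y\<close> corresponds to applying \<open>farey_right\<close> to \<open>1 - 1 / y\<close>, and in the next lemma to applying
  \<open>farey_left\<close> to \<open>1 / y\<close>. This is why the masses of the unit intervals decrease geometrically.\<close>

lemma question_mark_near_one:
  assumes "0 \<le> x" "x \<le> 1"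
  shows "question_mark (1 - 1 / (real n + 1 + x)) = 1 - (2 - question_mark x) / 2 ^ Suc n"
proof (induction n)
  case 0
  have "1 - 1 / (1 + x) = farey_left x"
    using assms by (simp add: farey_left_def field_simps)
  then have "question_mark (1 - 1 / (1 + x)) = question_mark x / 2"
    using question_mark_left[OF assms] by simp
  then show ?case
    by (simp add: diff_divide_distrib)
next
  case (Suc n)
  have "farey_right (1 - 1 / (real n + 1 + x)) = 1 - 1 / (real (Suc n) + 1 + x)"
    using assms by (simp add: farey_right_def field_simps)
  moreover have "0 \<le> 1 - 1 / (real n + 1 + x)" "1 - 1 / (real n + 1 + x) \<le> 1"
    using assms by (simp_all add: field_simps)
  ultimately have "question_mark (1 - 1 / (real (Suc n) + 1 + x)) =
      (1 + question_mark (1 - 1 / (real n + 1 + x))) / 2"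
    using question_mark_right[of "1 - 1 / (real n + 1 + x)"] by metis
  then show ?case
    unfolding Suc.IH by (simp add: field_simps)
qed

lemma question_mark_near_zero:
  assumes "0 \<le> x" "x \<le> 1"
  shows "question_mark (1 / (real n + 2 - x)) = (1 + question_mark x) / 2 ^ Suc n"
proof (induction n)
  case 0
  then show ?case
    using question_mark_right[OF assms] by (simp add: farey_right_def)
next
  case (Suc n)
  have "farey_left (1 / (real n + 2 - x)) = 1 / (real (Suc n) + 2 - x)"
    using assms by (simp add: farey_left_def field_simps)
  moreover have "0 \<le> 1 / (real n + 2 - x)" "1 / (real n + 2 - x) \<le> 1"
    using assms by (simp_all add: field_simps)
  ultimately have "question_mark (1 / (real (Suc n) + 2 - x)) = question_mark (1 / (real n + 2 - x)) / 2"
    using question_mark_left[of "1 / (real n + 2 - x)"] by metis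
  then show ?case
    unfolding Suc.IH by simp
qed

text \<open>The three summands are the distribution functions of the images of the Minkowski measure on
  \<open>[0, 1]\<close> under the identity, under \<open>t \<mapsto> 1 - 1 / t\<close> and under \<open>t \<mapsto> 1 / (1 - t)\<close>.\<close>

lemma ext_minkowski_eq:
  "ext_minkowski x = (question_mark x + (if x < 1 then question_mark (1 / (1 - x)) else 1) +
     (if 1 < x then question_mark (1 - 1 / x) else 0)) / 3"
proof (cases "0 \<le> x")
  case True
  define n where "n = nat \<lfloor>x\<rfloor>"
  have n: "\<lfloor>x\<rfloor> = int n"
    using True by (simp add: n_def)
  have f: "x = real n + frac x" "0 \<le> frac x" "frac x \<le> 1"
    using frac_lt_1[of x] frac_ge_0[of x] n by (simp_all add: frac_def less_imp_le del: frac_ge_0)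
  have "ext_minkowski x = (3 - 2 / 2 ^ n + question_mark (frac x) / 2 ^ n) / 3"
    using sum_below_nonneg[of n, THEN infsumI] f unfolding ext_minkowski_def n Let_def
    by (simp add: minkowski_eq)
  moreover have "question_mark (1 / (1 - x)) = 1" if "x < 1"
    using that True by simp
  moreover have "question_mark (1 - 1 / x) = 1 - (2 - question_mark (frac x)) / 2 ^ n" if "1 < x"
  proof -
    have "1 \<le> \<lfloor>x\<rfloor>"
      using that by linarith
    then obtain m where "n = Suc m"
      using n by (cases n) auto
    then show ?thesis
      using question_mark_near_one[OF f(2,3), of m] f(1) by (simp add: add.commute)
  qed
  moreover have "n = 0 \<and> frac x = x" if "x < 1"
    using that True n by (auto simp: frac_def n_def)
  moreover have "n = 1 \<and> frac x = 0" if "x = 1"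
    using that n by auto
  ultimately show ?thesis
    by (cases "x < 1"; cases "x = 1") (auto simp: diff_divide_distrib)
next
  case False
  define n where "n = nat (- \<lfloor>x\<rfloor> - 1)"
  have n: "\<lfloor>x\<rfloor> = - int (Suc n)"
    using False unfolding n_def by linarith
  have f: "x = frac x - real n - 1" "0 \<le> frac x" "frac x \<le> 1"
    using frac_lt_1[of x] frac_ge_0[of x] n by (simp_all add: frac_def less_imp_le del: frac_ge_0)
  have "1 - x = real n + 2 - frac x"
    using f(1) by simp
  have "ext_minkowski x = (1 / 2 ^ Suc n + question_mark (frac x) / 2 ^ Suc n) / 3"
    using sum_below_nonpos[of "Suc n", THEN infsumI] f unfolding ext_minkowski_def n Let_def
    by (simp add: minkowski_eq nat_add_distrib)
  moreover have "question_mark (1 / (1 - x)) = (1 + question_mark (frac x)) / 2 ^ Suc n"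
    unfolding \<open>1 - x = _\<close> by (rule question_mark_near_zero[OF f(2,3)])
  ultimately show ?thesis
    using False by (simp add: add_divide_distrib)
qed

section \<open>Mixtures of image measures\<close>

text \<open>A family of measurable maps indexed by a countable discrete space is jointly measurable. The three
  lemmas for such families serve for finite mixtures, for the multiplication of the group and for its
  action on the projective line.\<close>

lemma measurable_family:
  assumes "countable C" "sets M = Pow C" "\<And>g. g \<in> C \<Longrightarrow> h g \<in> N \<rightarrow>\<^sub>M L"
  shows "(\<lambda>(g, x). h g x) \<in> M \<Otimes>\<^sub>M N \<rightarrow>\<^sub>M L"
proof -
  have "(\<lambda>(g, x). h g x) \<in> count_space C \<Otimes>\<^sub>M N \<rightarrow>\<^sub>M L"
    using assms by (intro measurable_pair_measure_countable1) simp_all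
  moreover have "sets (M \<Otimes>\<^sub>M N) = sets (count_space C \<Otimes>\<^sub>M N)"
    using assms by (intro sets_pair_measure_cong) simp_all
  ultimately show ?thesis
    by (simp cong: measurable_cong_sets)
qed

lemma integral_family:
  fixes f :: "'c \<Rightarrow> real"
  assumes "prob_space M" "prob_space N"
    and "countable C" "sets M = Pow C" "\<And>g. g \<in> C \<Longrightarrow> h g \<in> N \<rightarrow>\<^sub>M L"
    and f: "f \<in> borel_measurable L" "\<And>x. \<bar>f x\<bar> \<le> B"
  shows "(\<integral>x. f x \<partial>distr (M \<Otimes>\<^sub>M N) L (\<lambda>(g, x). h g x)) = (\<integral>g. \<integral>x. f (h g x) \<partial>N \<partial>M)"
proof -
  interpret M: prob_space M by fact
  interpret N: prob_space N by fact
  interpret P: pair_prob_space M N ..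
  have m: "(\<lambda>(g, x). h g x) \<in> M \<Otimes>\<^sub>M N \<rightarrow>\<^sub>M L"
    using assms(3-5) by (rule measurable_family)
  have "integrable (M \<Otimes>\<^sub>M N) (\<lambda>z. f (case z of (g, x) \<Rightarrow> h g x))"
    using f(2) measurable_compose[OF m f(1)] by (intro P.integrable_const_bound[of _ B]) auto
  from P.integral_fst'[OF this] show ?thesis
    by (simp add: integral_distr[OF m f(1)])
qed

lemma prob_space_family:
  assumes "prob_space M" "prob_space N"
    and "countable C" "sets M = Pow C" "\<And>g. g \<in> C \<Longrightarrow> h g \<in> N \<rightarrow>\<^sub>M L"
  shows "prob_space (distr (M \<Otimes>\<^sub>M N) L (\<lambda>(g, x). h g x))"
proof -
  interpret M: prob_space M by fact
  interpret N: prob_space N by fact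
  interpret P: pair_prob_space M N ..
  show ?thesis
    using assms(3-5) by (intro P.prob_space_distr measurable_family)
qed

text \<open>The law of \<open>h i x\<close> for independent \<open>i\<close> and \<open>x\<close>, where \<open>i\<close> is uniformly distributed on \<open>I\<close>; in other words,
  the mean of the images of \<open>N\<close> under the maps \<open>h i\<close>.\<close>

definition mixture :: "'i set \<Rightarrow> ('i \<Rightarrow> 'a \<Rightarrow> 'b::topological_space) \<Rightarrow> 'a measure \<Rightarrow> 'b measure" where
  "mixture I h N = distr (uniform_count_measure I \<Otimes>\<^sub>M N) borel (\<lambda>(i, x). h i x)"

context
  fixes I :: "'i set" and h :: "'i \<Rightarrow> 'a \<Rightarrow> 'b::topological_space" and N :: "'a measure"
  assumes I: "finite I" "I \<noteq> {}" and N: "prob_space N"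
    and h: "\<And>i. i \<in> I \<Longrightarrow> h i \<in> borel_measurable N"
begin

lemma prob_space_mixture: "prob_space (mixture I h N)"
  unfolding mixture_def
  by (rule prob_space_family[where C = I])
    (simp_all add: I N h prob_space_uniform_count_measure countable_finite sets_uniform_count_measure)

lemma integral_mixture:
  assumes "f \<in> borel_measurable borel" "\<And>x. \<bar>f x\<bar> \<le> B"
  shows "(\<integral>x. f x \<partial>mixture I h N) = (\<Sum>i\<in>I. \<integral>x. f (h i x) \<partial>N) / real (card I)"
  unfolding mixture_def
  by (subst integral_family[where C = I and B = B])
    (simp_all add: I N h assms prob_space_uniform_count_measure countable_finite
      sets_uniform_count_measure integral_uniform_count_measure)

lemma measure_mixture:
  assumes "A \<in> sets borel"
  shows "measure (mixture I h N) A = (\<Sum>i\<in>I. measure N {x \<in> space N. h i x \<in> A}) / real (card I)"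
proof -
  interpret N: prob_space N by fact
  interpret M: prob_space "mixture I h N" by (rule prob_space_mixture)
  have A: "A \<in> sets (mixture I h N)"
    using assms by (simp add: mixture_def)
  have "measure (mixture I h N) A = (\<integral>x. indicator A x \<partial>mixture I h N)"
    using A sets.sets_into_space[OF A] by (simp add: Int_absorb2)
  also have "\<dots> = (\<Sum>i\<in>I. \<integral>x. indicator A (h i x) \<partial>N) / real (card I)"
    using assms by (intro integral_mixture[where B = 1]) (auto simp: indicator_def)
  also have "(\<Sum>i\<in>I. \<integral>x. indicator A (h i x) \<partial>N) = (\<Sum>i\<in>I. measure N {x \<in> space N. h i x \<in> A})"
  proof (rule sum.cong[OF refl])
    fix i assume "i \<in> I"
    have "(\<integral>x. indicator A (h i x) \<partial>N) = (\<integral>x. indicator {x \<in> space N. h i x \<in> A} x \<partial>N :: real)"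
      by (intro Bochner_Integration.integral_cong) (auto simp: indicator_def)
    then show "(\<integral>x. indicator A (h i x) \<partial>N) = measure N {x \<in> space N. h i x \<in> A}"
      by (simp add: Int_absorb2 Collect_subset)
  qed
  finally show ?thesis .
qed

end

section \<open>The Minkowski measure\<close>

definition minkowski_measure :: "real measure" where
  "minkowski_measure = interval_measure question_mark"

lemma question_mark_limits:
  "(question_mark \<longlongrightarrow> 0) at_bot" "(question_mark \<longlongrightarrow> 1) at_top"
  by (rule tendsto_eventually, auto intro: eventually_at_bot_linorderI[of 0] eventually_at_top_linorderI[of 1])+

lemma question_mark_right_continuous: "continuous (at_right x) question_mark"
  using question_mark_continuous
  by (simp add: continuous_on_eq_continuous_at continuous_at_imp_continuous_at_within)

lemma real_distribution_minkowski: "real_distribution minkowski_measure"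
  unfolding minkowski_measure_def
  by (intro real_distribution_interval_measure question_mark_mono question_mark_right_continuous
      question_mark_limits)

interpretation minkowski: real_distribution minkowski_measure
  by (rule real_distribution_minkowski)

lemma minkowski_measure_atMost: "measure minkowski_measure {..x} = question_mark x"
  unfolding minkowski_measure_def
  by (intro measure_interval_measure_Iic question_mark_mono question_mark_right_continuous
      question_mark_limits)

lemma minkowski_measure_singleton: "measure minkowski_measure {x} = 0"
proof -
  have "isCont (cdf minkowski_measure) x"
    using question_mark_continuous
    by (simp add: cdf_def minkowski_measure_atMost continuous_on_eq_continuous_at)
  then show ?thesis
    by (simp add: minkowski.isCont_cdf)
qed

text \<open>The measure has no atoms. The extra point \<open>x\<close> makes it possible to ignore the difference between
  strict and weak inequalities.\<close>

lemma AE_minkowski: "AE t in minkowski_measure. 0 < t \<and> t < 1 \<and> t \<noteq> x"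
proof -
  have "measure minkowski_measure {..0} = 0" "measure minkowski_measure (- {..1}) = 0"
    using minkowski.prob_compl[of "{..1}"]
    by (simp_all add: minkowski_measure_atMost Compl_eq_Diff_UNIV)
  then have "{..0} \<in> null_sets minkowski_measure" "- {..1} \<in> null_sets minkowski_measure"
    "{1} \<in> null_sets minkowski_measure" "{x} \<in> null_sets minkowski_measure"
    by (simp_all add: null_sets_def minkowski.emeasure_eq_measure minkowski_measure_singleton)
  from this[THEN AE_not_in] show ?thesis
    by eventually_elim auto
qed

lemma minkowski_measure_Collect:
  assumes "\<And>t. \<lbrakk>0 < t; t < 1; t \<noteq> y\<rbrakk> \<Longrightarrow> P t \<longleftrightarrow> t \<le> y" "Measurable.pred borel P"
  shows "measure minkowski_measure {t. P t} = question_mark y"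
proof -
  have [measurable]: "Measurable.pred borel P" by fact
  have "measure minkowski_measure {t. P t} = measure minkowski_measure {..y}"
  proof (rule minkowski.finite_measure_eq_AE)
    show "AE t in minkowski_measure. (t \<in> {t. P t}) = (t \<in> {..y})"
      using AE_minkowski[of y] by eventually_elim (use assms(1) in auto)
  qed auto
  then show ?thesis
    by (simp add: minkowski_measure_atMost)
qed

lemma farey_left_measurable: "(farey_left :: real \<Rightarrow> real) \<in> borel_measurable borel"
  and farey_right_measurable: "(farey_right :: real \<Rightarrow> real) \<in> borel_measurable borel"
  unfolding farey_left_def[abs_def] farey_right_def[abs_def] by measurable

lemma farey_left_neq_right: "farey_left \<noteq> (farey_right :: real \<Rightarrow> real)"
proof
  assume "farey_left = (farey_right :: real \<Rightarrow> real)"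
  then have "farey_left (0 :: real) = farey_right 0"
    by simp
  then show False
    by (simp add: farey_left_def farey_right_def)
qed

text \<open>In terms of distribution functions this is the fixed point equation of the Minkowski function.\<close>

lemma minkowski_measure_self_similar:
  "mixture {farey_left, farey_right} (\<lambda>h. h) minkowski_measure = minkowski_measure"
proof (rule cdf_unique)
  note m = farey_left_measurable farey_right_measurable and ne = farey_left_neq_right
  have m': "h \<in> borel_measurable minkowski_measure" if "h \<in> {farey_left, farey_right}" for h
    using m that by auto
  show "real_distribution (mixture {farey_left, farey_right} (\<lambda>h. h) minkowski_measure)"
    using prob_space_mixture[of "{farey_left, farey_right}" minkowski_measure "\<lambda>h. h", OF _ _ _ m']
    by (auto simp: real_distribution_def real_distribution_axioms_def mixture_def minkowski.prob_space_axioms)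
  show "real_distribution minkowski_measure"
    by (rule real_distribution_minkowski)
  show "cdf (mixture {farey_left, farey_right} (\<lambda>h. h) minkowski_measure) = cdf minkowski_measure"
  proof
    fix x :: real
    have L: "measure minkowski_measure {t. farey_left t \<le> x} =
      (if x \<le> 1/2 then question_mark (x / (1 - x)) else 1)"
    proof (cases "x \<le> 1/2")
      case True
      have "measure minkowski_measure {t. farey_left t \<le> x} = question_mark (x / (1 - x))"
        using m True by (intro minkowski_measure_Collect) (auto simp: farey_left_def field_simps)
      then show ?thesis
        using True by simp
    next
      case False
      have "measure minkowski_measure {t. farey_left t \<le> x} = question_mark 1"
      proof (rule minkowski_measure_Collect)
        show "farey_left t \<le> x \<longleftrightarrow> t \<le> 1" if "0 < t" "t < 1" for t
          using farey_left_range[of t] that False by simp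
      qed (use m in measurable)
      then show ?thesis
        using False by simp
    qed
    have R: "measure minkowski_measure {t. farey_right t \<le> x} =
      (if x \<le> 1/2 then 0 else question_mark (2 - 1 / x))"
    proof (cases "x \<le> 1/2")
      case True
      have "measure minkowski_measure {t. farey_right t \<le> x} = question_mark 0"
      proof (rule minkowski_measure_Collect)
        show "farey_right t \<le> x \<longleftrightarrow> t \<le> 0" if "0 < t" "t < 1" for t
        proof -
          have "1/2 < farey_right t"
            using that by (simp add: farey_right_def field_simps)
          then show ?thesis
            using that True by simp
        qed
      qed (use m in measurable)
      then show ?thesis
        using True by simp
    next
      case False
      have "measure minkowski_measure {t. farey_right t \<le> x} = question_mark (2 - 1 / x)"
        using m False by (intro minkowski_measure_Collect) (auto simp: farey_right_def field_simps)
      then show ?thesis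
        using False by simp
    qed
    have "measure (mixture {farey_left, farey_right} (\<lambda>h. h) minkowski_measure) {..x} =
      (measure minkowski_measure {t. farey_left t \<le> x} + measure minkowski_measure {t. farey_right t \<le> x}) / 2"
      using ne m' by (subst measure_mixture) (auto simp: minkowski.prob_space_axioms)
    also have "\<dots> = question_mark x"
      using question_mark_lower[of x] question_mark_upper[of x] by (simp add: L R)
    finally show "cdf (mixture {farey_left, farey_right} (\<lambda>h. h) minkowski_measure) x = cdf minkowski_measure x"
      by (simp add: cdf_def minkowski_measure_atMost)
  qed
qed

lemma integral_minkowski_self_similar:
  fixes f :: "real \<Rightarrow> real"
  assumes "f \<in> borel_measurable borel" "\<And>x. \<bar>f x\<bar> \<le> B"
  shows "(\<integral>t. f t \<partial>minkowski_measure) =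
    ((\<integral>t. f (farey_left t) \<partial>minkowski_measure) + (\<integral>t. f (farey_right t) \<partial>minkowski_measure)) / 2"
proof -
  note m = farey_left_measurable farey_right_measurable and ne = farey_left_neq_right
  have "(\<integral>t. f t \<partial>minkowski_measure) =
      (\<integral>t. f t \<partial>mixture {farey_left, farey_right} (\<lambda>h. h) minkowski_measure)"
    by (simp add: minkowski_measure_self_similar)
  also have "\<dots> = (\<Sum>h\<in>{farey_left, farey_right}. \<integral>t. f (h t) \<partial>minkowski_measure) /
      real (card {farey_left, farey_right :: real \<Rightarrow> real})"
    using m by (intro integral_mixture[OF _ _ _ _ assms]) (auto simp: minkowski.prob_space_axioms)
  finally show ?thesis
    using ne by simp
qed


section \<open>The action on the projective line\<close>

definition mat2 :: "real \<Rightarrow> real \<Rightarrow> real \<Rightarrow> real \<Rightarrow> real^2^2" where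
  "mat2 p q r s = vector [vector [p, q], vector [r, s]]"

lemma mat2_mult: "mat2 p q r s ** mat2 p' q' r' s' =
    mat2 (p * p' + q * r') (p * q' + q * s') (r * p' + s * r') (r * q' + s * s')"
  by (simp add: mat2_def vec_eq_iff forall_2 matrix_matrix_mult_def sum_2)

lemma mat2_uminus: "- mat2 p q r s = mat2 (- p) (- q) (- r) (- s)"
  by (simp add: mat2_def vec_eq_iff forall_2)

lemma mat2_one: "mat2 1 0 0 1 = mat 1"
  by (simp add: mat2_def vec_eq_iff forall_2 mat_def)

lemma mat2_eq_iff: "mat2 p q r s = mat2 p' q' r' s' \<longleftrightarrow> p = p' \<and> q = q' \<and> r = r' \<and> s = s'"
  by (auto simp: mat2_def vec_eq_iff forall_2)

lemma mat2_vector: "mat2 p q r s *v vector [x, y] = vector [p * x + q * y, r * x + s * y]"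
  by (simp add: mat2_def vec_eq_iff forall_2 matrix_vector_mult_def sum_2)

lemma det_mat2: "det (mat2 p q r s) = p * s - q * r"
  by (simp add: mat2_def det_2)

lemma psl_class_eq: "psl_class A = {A, - A}"
proof -
  have "(- mat 1) ** A = - A"
    by (simp add: vec_eq_iff matrix_matrix_mult_def mat_def if_distrib[of "\<lambda>x. - x"]
        if_distrib[of "\<lambda>x. x * _"] sum.delta cong: if_cong)
  then show ?thesis
    by (auto simp: psl_class_def r_coset_def SL2R_def)
qed

lemma proj_line_cases:
  obtains v :: "real^2" where "v \<noteq> 0" "x = proj_class v"
proof -
  have L: "subspace (line_set x)" "dim (line_set x) = 1"
    using line_set[of x] by auto
  obtain B where B: "B \<subseteq> line_set x" "independent B" "line_set x \<subseteq> span B" "card B = 1"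
    using basis_exists[of "line_set x"] L(2) by metis
  then obtain v where "B = {v}"
    by (auto simp: card_1_singleton_iff)
  with B have "v \<noteq> 0" "line_set x = span {v}"
    using L(1) by (auto simp: dependent_zero intro: span_minimal[THEN subsetD])
  then show ?thesis
    by (intro that[of v]) (simp_all add: proj_class_def line_set_inverse flip: \<open>line_set x = span {v}\<close>)
qed

lemma line_set_proj_class:
  assumes "v \<noteq> 0"
  shows "line_set (proj_class v) = span {v}"
  unfolding proj_class_def
  using assms by (intro Abs_proj_line_inverse) (simp add: dim_eq_card_independent)

lemma proj_class_scale:
  assumes "k \<noteq> 0"
  shows "proj_class (k *\<^sub>R v) = proj_class v"
proof -
  have "(1 / k) *\<^sub>R (k *\<^sub>R v) \<in> span {k *\<^sub>R v}"
    by (intro span_scale span_base) simp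
  then have "span {k *\<^sub>R v} = span {v}"
    using assms by (simp add: span_eq span_base span_scale)
  then show ?thesis
    by (simp add: proj_class_def)
qed

text \<open>The action of a class through a representing matrix, which makes matrix computations applicable.\<close>

definition act :: "real^2^2 \<Rightarrow> proj_line \<Rightarrow> proj_line" where
  "act A = proj_act (psl_class A)"

lemma det_one_vector_nonzero:
  fixes A :: "real^2^2"
  assumes "det A = 1" "v \<noteq> 0"
  shows "A *v v \<noteq> 0"
proof
  assume "A *v v = 0"
  moreover have "inj ((*v) A)"
    using assms(1) by (intro inj_matrix_vector_mult) (simp add: invertible_det_nz)
  ultimately have "v = 0"
    by (auto dest: injD[where y = 0])
  with assms(2) show False
    by simp
qed

lemma act_proj_class:
  assumes "det A = 1" "v \<noteq> 0"
  shows "act A (proj_class v) = proj_class (A *v v)"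
proof -
  have *: "(\<lambda>v. M *v v) ` span {v} = span {M *v v}" for M :: "real^2^2"
    using linear_span_image[of "(*v) M" "{v}"] by (simp add: matrix_vector_mul_linear)
  have "(- A) *v v = - (A *v v)"
    by (simp add: vec_eq_iff matrix_vector_mult_def sum_negf)
  moreover have "- (- (A *v v)) \<in> span {- (A *v v)}"
    by (intro span_neg span_base) simp
  ultimately have "span {(- A) *v v} = span {A *v v}"
    by (simp add: span_eq span_base span_neg)
  then have "(\<Union>M\<in>psl_class A. (\<lambda>v. M *v v) ` line_set (proj_class v)) = span {A *v v}"
    using assms by (simp add: psl_class_eq line_set_proj_class *)
  then show ?thesis
    by (simp add: act_def proj_act_def proj_class_def)
qed

lemma act_mult: "det A = 1 \<Longrightarrow> det B = 1 \<Longrightarrow> act (A ** B) x = act A (act B x)"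
  by (cases x rule: proj_line_cases)
    (simp add: act_proj_class det_mul det_one_vector_nonzero matrix_vector_mul_assoc)

lemma act_uminus: "act (- A) = act A"
  by (simp add: act_def psl_class_eq insert_commute)

lemma act_one: "act (mat 1) x = x"
  by (cases x rule: proj_line_cases) (simp add: act_proj_class)

lemma continuous_act:
  assumes "det A = 1"
  shows "continuous_on UNIV (act A)"
  unfolding continuous_on_open_vimage[OF open_UNIV]
proof (intro allI impI)
  fix U :: "proj_line set" assume "open U"
  then have "open {v. v \<noteq> 0 \<and> proj_class v \<in> U}"
    by (simp add: open_proj_line_def)
  then have "open ((*v) A -` {v. v \<noteq> 0 \<and> proj_class v \<in> U})"
    by (rule open_vimage) (simp add: linear_continuous_on matrix_vector_mul_bounded_linear)
  also have "(*v) A -` {v. v \<noteq> 0 \<and> proj_class v \<in> U} = {v. v \<noteq> 0 \<and> proj_class v \<in> act A -` U}"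
  proof (rule Set.set_eqI)
    show "v \<in> (*v) A -` {v. v \<noteq> 0 \<and> proj_class v \<in> U} \<longleftrightarrow> v \<in> {v. v \<noteq> 0 \<and> proj_class v \<in> act A -` U}" for v
      using assms by (cases "v = 0") (simp_all add: act_proj_class det_one_vector_nonzero)
  qed
  finally show "open (act A -` U \<inter> UNIV)"
    by (simp add: open_proj_line_def)
qed

lemma vector_eq_0_iff: "vector [x, y] = (0 :: real^2) \<longleftrightarrow> x = 0 \<and> y = 0"
  by (simp add: vec_eq_iff forall_2)

lemma continuous_proj_of_real: "continuous_on UNIV proj_of_real"
  unfolding continuous_on_open_vimage[OF open_UNIV]
proof (intro allI impI)
  fix U :: "proj_line set" assume "open U"
  then have "open {v. v \<noteq> 0 \<and> proj_class v \<in> U}"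
    by (simp add: open_proj_line_def)
  moreover have "continuous_on UNIV (\<lambda>t. vector [t, 1] :: real^2)"
  proof -
    have "(\<lambda>t. vector [t, 1] :: real^2) = (\<lambda>t. t *\<^sub>R axis 1 1 + axis 2 1)"
      by (simp add: fun_eq_iff vec_eq_iff forall_2 axis_def)
    then show ?thesis
      by (simp only:) (intro continuous_intros)
  qed
  ultimately have "open ((\<lambda>t. vector [t, 1]) -` {v :: real^2. v \<noteq> 0 \<and> proj_class v \<in> U})"
    by (rule open_vimage)
  then show "open (proj_of_real -` U \<inter> UNIV)"
    by (simp add: proj_of_real_def vimage_def vector_eq_0_iff)
qed

lemma proj_class_eq_proj_of_real: "y \<noteq> 0 \<Longrightarrow> proj_class (vector [x, y]) = proj_of_real (x / y)"
proof -
  assume "y \<noteq> 0"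
  then have "y *\<^sub>R vector [x / y, 1] = (vector [x, y] :: real^2)"
    by (simp add: vec_eq_iff forall_2)
  then show ?thesis
    using proj_class_scale[OF \<open>y \<noteq> 0\<close>, of "vector [x / y, 1]"] by (simp add: proj_of_real_def)
qed

lemma act_proj_of_real:
  assumes "p * s - q * r = 1"
  shows "act (mat2 p q r s) (proj_of_real t) = proj_class (vector [p * t + q, r * t + s])"
  unfolding proj_of_real_def using assms
  by (subst act_proj_class) (simp_all add: det_mat2 mat2_vector vector_eq_0_iff)

section \<open>The threefold symmetry\<close>

text \<open>The map \<open>x \<mapsto> 1 / (1 - x)\<close>, which permutes \<open>0\<close>, \<open>1\<close>, \<open>\<infinity>\<close> cyclically. Conjugation by it permutes the
  generators of the Farey group cyclically.\<close>

definition rot :: "proj_line \<Rightarrow> proj_line" where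
  "rot = act (mat2 0 1 (- 1) 1)"

text \<open>The half turn about the side of the triangle from \<open>0\<close> to \<open>1\<close>; it exchanges the arc \<open>[0, 1]\<close> with its
  complement.\<close>

definition side_flip :: "proj_line \<Rightarrow> proj_line" where
  "side_flip = act farey_c"

lemma farey_mat2: "farey_a = mat2 1 (- 2) 1 (- 1)" "farey_b = mat2 0 (- 1) 1 0" "farey_c = mat2 1 (- 1) 2 (- 1)"
  by (simp_all add: farey_a_def farey_b_def farey_c_def mat2_def)

lemma det_farey: "det farey_a = 1" "det farey_b = 1" "det farey_c = 1"
  by (simp_all add: farey_mat2 det_mat2)

lemma rot_rot_rot [simp]: "rot (rot (rot x)) = x"
proof -
  have "rot (rot (rot x)) = act (- mat 1) x"
    unfolding rot_def by (simp add: det_mat2 mat2_mult mat2_uminus flip: act_mult mat2_one)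
  then show ?thesis
    by (simp add: act_uminus act_one)
qed

lemma side_flip_side_flip [simp]: "side_flip (side_flip x) = x"
proof -
  have "side_flip (side_flip x) = act (- mat 1) x"
    unfolding side_flip_def farey_mat2 by (simp add: det_mat2 mat2_mult mat2_uminus flip: act_mult mat2_one)
  then show ?thesis
    by (simp add: act_uminus act_one)
qed

text \<open>The other two generators are the half turns about the other two sides, hence conjugates of \<open>side_flip\<close>.
  The matrix products agree up to a sign, which disappears in the projective action.\<close>

lemma act_farey_a: "act farey_a x = rot (side_flip (rot (rot x)))"
proof -
  have "rot (side_flip (rot (rot x))) = act (- farey_a) x"
    unfolding rot_def side_flip_def farey_mat2 by (simp add: det_mat2 mat2_mult mat2_uminus flip: act_mult)
  then show ?thesis
    by (simp add: act_uminus)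
qed

lemma act_farey_b: "act farey_b x = rot (rot (side_flip (rot x)))"
proof -
  have "rot (rot (side_flip (rot x))) = act (- farey_b) x"
    unfolding rot_def side_flip_def farey_mat2 by (simp add: det_mat2 mat2_mult mat2_uminus flip: act_mult)
  then show ?thesis
    by (simp add: act_uminus)
qed

lemma act_farey_c: "act farey_c x = side_flip x"
  by (simp add: side_flip_def)

text \<open>The link between the action and the Farey subdivision: \<open>rot\<close> moves the arc \<open>[0, 1]\<close> to one of the other
  two arcs, and \<open>side_flip\<close> brings it back as one half of \<open>[0, 1]\<close>.\<close>

lemma side_flip_rot_left:
  assumes "0 \<le> t" "t \<le> 1"
  shows "side_flip (rot (proj_of_real t)) = proj_of_real (farey_left t)"
proof -
  have "side_flip (rot (proj_of_real t)) = act (mat2 1 0 1 1) (proj_of_real t)"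
    unfolding rot_def side_flip_def farey_mat2 by (simp add: det_mat2 mat2_mult flip: act_mult)
  also have "\<dots> = proj_of_real (farey_left t)"
    using assms by (simp add: act_proj_of_real proj_class_eq_proj_of_real farey_left_def add.commute)
  finally show ?thesis .
qed

lemma side_flip_rot_right:
  assumes "0 \<le> t" "t \<le> 1"
  shows "side_flip (rot (rot (proj_of_real t))) = proj_of_real (farey_right t)"
proof -
  have "side_flip (rot (rot (proj_of_real t))) = act (mat2 0 1 (- 1) 2) (proj_of_real t)"
    unfolding rot_def side_flip_def farey_mat2 by (simp add: det_mat2 mat2_mult flip: act_mult)
  also have "\<dots> = proj_of_real (farey_right t)"
    using assms by (simp add: act_proj_of_real proj_class_eq_proj_of_real farey_right_def)
  finally show ?thesis .
qed

lemma side_flip_left: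
  assumes "0 \<le> t" "t \<le> 1"
  shows "side_flip (proj_of_real (farey_left t)) = rot (proj_of_real t)"
  using assms by (simp flip: side_flip_rot_left)

lemma side_flip_right:
  assumes "0 \<le> t" "t \<le> 1"
  shows "side_flip (proj_of_real (farey_right t)) = rot (rot (proj_of_real t))"
  using assms by (simp flip: side_flip_rot_right)

lemma rot_proj_of_real: "t \<noteq> 1 \<Longrightarrow> rot (proj_of_real t) = proj_of_real (1 / (1 - t))"
  by (simp add: rot_def act_proj_of_real proj_class_eq_proj_of_real)

lemma continuous_rot: "continuous_on UNIV rot"
  unfolding rot_def by (rule continuous_act) (simp add: det_mat2)

text \<open>The three arcs \<open>[0, 1]\<close>, \<open>[1, \<infinity>]\<close> and \<open>[\<infinity>, 0]\<close> are the images of the first one under powers of \<open>rot\<close>.\<close>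

lemma proj_line_rot_cases:
  obtains i t where "i < 3" "0 \<le> t" "t \<le> 1" "x = (rot ^^ i) (proj_of_real t)"
proof -
  obtain v where v: "v \<noteq> 0" "x = proj_class v"
    by (rule proj_line_cases)
  define u w where "u = v $ 1" and "w = v $ 2"
  have uw: "v = vector [u, w]"
    by (simp add: vec_eq_iff forall_2 u_def w_def)
  show ?thesis
  proof (cases "w = 0")
    case True
    then have "u \<noteq> 0"
      using v(1) by (simp add: uw vector_eq_0_iff)
    have r: "rot (proj_of_real 1) = proj_class (vector [1, 0])"
      by (simp add: rot_def act_proj_of_real)
    have u: "u *\<^sub>R vector [1, 0] = v"
      by (simp add: uw True vec_eq_iff forall_2)
    have "proj_class (vector [1, 0]) = x"
      using u proj_class_scale[OF \<open>u \<noteq> 0\<close>, of "vector [1, 0]"] v(2) by simp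
    with r show ?thesis
      by (intro that[of 1 1]) simp_all
  next
    case False
    define s where "s = u / w"
    have x: "x = proj_of_real s"
      using False by (simp add: v(2) uw proj_class_eq_proj_of_real s_def)
    consider "0 \<le> s" "s \<le> 1" | "s > 1" | "s < 0"
      by linarith
    then show ?thesis
    proof cases
      case 1
      then show ?thesis
        by (intro that[of 0 s]) (simp_all add: x)
    next
      case 2
      then have "rot (proj_of_real (1 - 1 / s)) = x"
        by (simp add: rot_proj_of_real x)
      then show ?thesis
        using 2 by (intro that[of 1 "1 - 1 / s"]) simp_all
    next
      case 3
      have "rot (proj_of_real s) = proj_of_real (1 / (1 - s))"
        using 3 by (simp add: rot_proj_of_real)
      then have "rot (rot (proj_of_real (1 / (1 - s)))) = x"
        by (metis rot_rot_rot x)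
      then show ?thesis
        using 3 by (intro that[of 2 "1 / (1 - s)"]) (simp_all add: numeral_2_eq_2)
    qed
  qed
qed

section \<open>The Farey group\<close>

lemma psl_mult: "psl_class A \<otimes>\<^bsub>farey_group\<^esub> psl_class B = psl_class (A ** B)"
proof -
  have "A ** (- B) = - (A ** B)" "(- A) ** B = - (A ** B)" for A B :: "real^2^2"
    by (simp_all add: vec_eq_iff matrix_matrix_mult_def sum_negf)
  then show ?thesis
    by (auto simp: farey_group_def PSL2Z_def PSL2R_def FactGroup_def set_mult_def psl_class_eq SL2R_def)
qed

lemma psl_one: "\<one>\<^bsub>farey_group\<^esub> = psl_class (mat 1)"
  by (simp add: farey_group_def PSL2Z_def PSL2R_def FactGroup_def psl_class_eq)


text \<open>By induction over the generated group. For inverses it matters that the generators are involutions: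
  each of the three matrices squares to \<open>- 1\<close>.\<close>

lemma farey_group_elem:
  assumes "g \<in> carrier farey_group"
  obtains A where "g = psl_class A" "det A = 1" "\<forall>i j. A $ i $ j \<in> \<int>"
proof -
  define Z where "Z = {A :: real^2^2. det A = 1 \<and> (\<forall>i j. A $ i $ j \<in> \<int>)}"
  have mult: "A ** B \<in> Z" if "A \<in> Z" "B \<in> Z" for A B
  proof -
    have "(A ** B) $ i $ j \<in> \<int>" for i j
      using that by (auto simp: Z_def matrix_matrix_mult_def intro!: Ints_sum Ints_mult)
    then show ?thesis
      using that by (simp add: Z_def det_mul)
  qed
  have gens: "{farey_a, farey_b, farey_c} \<subseteq> Z"
    by (simp add: Z_def det_farey farey_mat2 det_mat2) (simp add: mat2_def forall_2)
  have PSL2Z: "psl_class A \<otimes>\<^bsub>PSL2Z\<^esub> psl_class B = psl_class (A ** B)"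
      "\<one>\<^bsub>PSL2Z\<^esub> = psl_class (mat 1)" "carrier PSL2Z = psl_class ` Z" for A B
    using psl_mult[of A B] psl_one by (simp_all add: farey_group_def PSL2Z_def SL2R_def Z_def Collect_conj_eq)
  have id: "mat 1 \<in> Z"
    by (simp add: Z_def) (simp add: mat_def)
  \<comment> \<open>The generators are involutions in the projective group.\<close>
  have square: "A ** A = - mat 1" if "A \<in> {farey_a, farey_b, farey_c}" for A
    using that by (auto simp: farey_mat2 mat2_mult mat2_uminus simp flip: mat2_one)
  have self_inverse: "inv\<^bsub>PSL2Z\<^esub> psl_class A = psl_class A" if "A \<in> {farey_a, farey_b, farey_c}" for A
    unfolding m_inv_def
  proof (rule the_equality)
    have "psl_class (A ** A) = psl_class (mat 1)"
      by (simp add: square[OF that] psl_class_eq insert_commute)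
    then show "psl_class A \<in> carrier PSL2Z \<and> psl_class A \<otimes>\<^bsub>PSL2Z\<^esub> psl_class A = \<one>\<^bsub>PSL2Z\<^esub> \<and>
        psl_class A \<otimes>\<^bsub>PSL2Z\<^esub> psl_class A = \<one>\<^bsub>PSL2Z\<^esub>"
      using gens that by (auto simp: PSL2Z)
  next
    fix y
    assume y: "y \<in> carrier PSL2Z \<and> psl_class A \<otimes>\<^bsub>PSL2Z\<^esub> y = \<one>\<^bsub>PSL2Z\<^esub> \<and>
        y \<otimes>\<^bsub>PSL2Z\<^esub> psl_class A = \<one>\<^bsub>PSL2Z\<^esub>"
    then obtain B where B: "y = psl_class B"
      by (auto simp: PSL2Z)
    with y have "psl_class (A ** B) = psl_class (mat 1)"
      by (simp add: PSL2Z)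
    then have "psl_class A = psl_class A \<otimes>\<^bsub>PSL2Z\<^esub> psl_class (A ** B)"
      by (simp add: PSL2Z)
    also have "\<dots> = psl_class ((A ** A) ** B)"
      by (simp add: PSL2Z matrix_mul_assoc)
    also have "\<dots> = psl_class (- mat 1) \<otimes>\<^bsub>PSL2Z\<^esub> psl_class B"
      by (simp add: PSL2Z square[OF that])
    also have "psl_class (- mat 1) = psl_class (mat 1)"
      by (simp add: psl_class_eq insert_commute)
    finally show "y = psl_class A"
      by (simp add: PSL2Z B)
  qed
  have "g \<in> generate PSL2Z {psl_class farey_a, psl_class farey_b, psl_class farey_c}"
    using assms by (simp add: farey_group_def)
  then have "g \<in> psl_class ` Z"
  proof (induction rule: generate.induct)
    case one
    then show ?case
      using id by (auto simp: PSL2Z)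
  next
    case (incl h)
    then show ?case
      using gens by auto
  next
    case (inv h)
    then show ?case
      using gens self_inverse by auto
  next
    case (eng h1 h2)
    then show ?case
      using mult by (auto simp: PSL2Z)
  qed
  then show ?thesis
    using that by (auto simp: Z_def)
qed

text \<open>Countability makes the multiplication and the action measurable on product spaces.\<close>

lemma countable_farey_group: "countable (carrier farey_group)"
proof (rule countable_subset)
  show "carrier farey_group \<subseteq> range (\<lambda>(p, q, r, s). psl_class (mat2 (of_int p) (of_int q) (of_int r) (of_int s)))"
  proof
    fix g assume "g \<in> carrier farey_group"
    then obtain A where A: "g = psl_class A" "\<forall>i j. A $ i $ j \<in> \<int>"
      by (rule farey_group_elem)
    then obtain p q r s where "A $ 1 $ 1 = of_int p" "A $ 1 $ 2 = of_int q" "A $ 2 $ 1 = of_int r" "A $ 2 $ 2 = of_int s"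
      by (metis Ints_cases)
    then have "A = mat2 (of_int p) (of_int q) (of_int r) (of_int s)"
      by (simp add: mat2_def vec_eq_iff forall_2)
    then show "g \<in> range (\<lambda>(p, q, r, s). psl_class (mat2 (of_int p) (of_int q) (of_int r) (of_int s)))"
      using A(1) by (auto intro!: image_eqI[where x = "(p, q, r, s)"])
  qed
qed simp

lemma farey_group_mult_closed:
  "g \<in> carrier farey_group \<Longrightarrow> h \<in> carrier farey_group \<Longrightarrow> g \<otimes>\<^bsub>farey_group\<^esub> h \<in> carrier farey_group"
  by (simp add: farey_group_def generate.eng)

lemma farey_group_one_closed: "\<one>\<^bsub>farey_group\<^esub> \<in> carrier farey_group"
  by (simp add: farey_group_def generate.one)

lemma farey_group_generators:
  "psl_class farey_a \<in> carrier farey_group" "psl_class farey_b \<in> carrier farey_group"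
  "psl_class farey_c \<in> carrier farey_group"
  by (simp_all add: farey_group_def generate.incl)

lemma proj_act_mult:
  assumes "g \<in> carrier farey_group" "h \<in> carrier farey_group"
  shows "proj_act (g \<otimes>\<^bsub>farey_group\<^esub> h) x = proj_act g (proj_act h x)"
  using assms by (elim farey_group_elem) (simp add: psl_mult act_mult flip: act_def)

lemma proj_act_one: "proj_act \<one>\<^bsub>farey_group\<^esub> x = x"
  by (simp add: psl_one act_one flip: act_def)

lemma proj_act_measurable:
  assumes "g \<in> carrier farey_group"
  shows "proj_act g \<in> borel_measurable borel"
proof -
  obtain A where "g = psl_class A" "det A = 1"
    using assms by (rule farey_group_elem)
  then show ?thesis
    using borel_measurable_continuous_onI[OF continuous_act[of A]] by (simp add: act_def)
qed

lemma farey_generators_distinct: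
  "psl_class farey_a \<noteq> psl_class farey_b" "psl_class farey_a \<noteq> psl_class farey_c"
  "psl_class farey_b \<noteq> psl_class farey_c"
  by (simp_all add: psl_class_eq farey_mat2 mat2_uminus mat2_eq_iff doubleton_eq_iff)


section \<open>The extended Minkowski measure\<close>

text \<open>The map \<open>rot\<close> in the affine coordinate, which is correct for \<open>t \<noteq> 1\<close>, hence almost everywhere.\<close>

definition real_rot :: "real \<Rightarrow> real" where
  "real_rot t = 1 / (1 - t)"

text \<open>The mean of the three copies of the Minkowski measure, one on each arc.\<close>

definition rot_mixture :: "real measure" where
  "rot_mixture = mixture {..<3} (\<lambda>i. real_rot ^^ i) minkowski_measure"

lemma real_rot_measurable: "(real_rot ^^ i) \<in> borel_measurable borel"
proof (induction i)
  case (Suc i)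
  have "real_rot \<in> borel_measurable borel"
    unfolding real_rot_def[abs_def] by measurable
  with Suc show ?case
    by (simp add: measurable_comp)
qed (simp add: id_def)

lemma prob_space_rot_mixture: "prob_space rot_mixture"
  unfolding rot_mixture_def
  by (rule prob_space_mixture)
    (simp_all add: lessThan_empty_iff minkowski.prob_space_axioms real_rot_measurable)

lemma measure_rot_mixture: "measure rot_mixture {..<x} = ext_minkowski x"
proof -
  have sum: "(\<Sum>i<3. g i) = g 0 + g 1 + (g 2 :: real)" for g :: "nat \<Rightarrow> real"
    by (simp add: eval_nat_numeral)
  have m: "{t. (real_rot ^^ i) t < x} \<in> sets borel" for i
    using real_rot_measurable[of i] by measurable
  have 0: "measure minkowski_measure {t. (real_rot ^^ 0) t < x} = question_mark x"
    using m by (intro minkowski_measure_Collect) (auto simp: pred_def)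
  have 1: "measure minkowski_measure {t. (real_rot ^^ 1) t < x} = (if 1 < x then question_mark (1 - 1 / x) else 0)"
  proof (cases "1 < x")
    case True
    have "measure minkowski_measure {t. (real_rot ^^ 1) t < x} = question_mark (1 - 1 / x)"
    proof (rule minkowski_measure_Collect)
      show "(real_rot ^^ 1) t < x \<longleftrightarrow> t \<le> 1 - 1 / x" if "0 < t" "t < 1" "t \<noteq> 1 - 1 / x" for t
      proof -
        have "(real_rot ^^ 1) t < x \<longleftrightarrow> t < 1 - 1 / x"
          using that True by (simp add: real_rot_def field_simps)
        then show ?thesis
          using that by auto
      qed
    qed (use m[of 1] in \<open>simp add: pred_def\<close>)
    then show ?thesis
      using True by simp
  next
    case False
    have "measure minkowski_measure {t. (real_rot ^^ 1) t < x} = question_mark 0"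
    proof (rule minkowski_measure_Collect)
      show "(real_rot ^^ 1) t < x \<longleftrightarrow> t \<le> 0" if "0 < t" "t < 1" for t
      proof -
        have "1 < real_rot t"
          using that by (simp add: real_rot_def)
        then show ?thesis
          using that False by simp
      qed
    qed (use m[of 1] in \<open>simp add: pred_def\<close>)
    then show ?thesis
      using False by simp
  qed
  have 2: "measure minkowski_measure {t. (real_rot ^^ 2) t < x} = (if x < 1 then question_mark (1 / (1 - x)) else 1)"
  proof (cases "x < 1")
    case True
    have "measure minkowski_measure {t. (real_rot ^^ 2) t < x} = question_mark (1 / (1 - x))"
    proof (rule minkowski_measure_Collect)
      show "(real_rot ^^ 2) t < x \<longleftrightarrow> t \<le> 1 / (1 - x)" if "0 < t" "t < 1" "t \<noteq> 1 / (1 - x)" for t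
      proof -
        have "(real_rot ^^ 2) t = 1 - 1 / t"
          using that by (simp add: real_rot_def numeral_2_eq_2 field_simps)
        moreover have "1 - 1 / t < x \<longleftrightarrow> t < 1 / (1 - x)"
          using that True by (simp add: field_simps)
        ultimately show ?thesis
          using that by auto
      qed
    qed (use m in \<open>simp add: pred_def\<close>)
    then show ?thesis
      using True by simp
  next
    case False
    have "measure minkowski_measure {t. (real_rot ^^ 2) t < x} = question_mark 1"
    proof (rule minkowski_measure_Collect)
      show "(real_rot ^^ 2) t < x \<longleftrightarrow> t \<le> 1" if "0 < t" "t < 1" for t
      proof -
        have "(real_rot ^^ 2) t = 1 - 1 / t"
          using that by (simp add: real_rot_def numeral_2_eq_2 field_simps)
        moreover have "1 - 1 / t < 0"
          using that by (simp add: field_simps)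
        ultimately show ?thesis
          using that False by linarith
      qed
    qed (use m in \<open>simp add: pred_def\<close>)
    then show ?thesis
      using False by simp
  qed
  have "measure rot_mixture {..<x} = (\<Sum>i<3. measure minkowski_measure {t. (real_rot ^^ i) t < x}) / 3"
    unfolding rot_mixture_def
    by (subst measure_mixture) (simp_all add: lessThan_empty_iff minkowski.prob_space_axioms real_rot_measurable)
  then show ?thesis
    unfolding sum 0 1 2 ext_minkowski_eq by (simp add: ac_simps)
qed

lemma ext_minkowski_measure_real_eq: "ext_minkowski_measure_real = rot_mixture"
  unfolding ext_minkowski_measure_real_def
proof (rule the_equality)
  interpret R: prob_space rot_mixture
    by (rule prob_space_rot_mixture)
  have sets: "sets rot_mixture = sets borel"
    by (simp add: rot_mixture_def mixture_def)
  have R: "measure rot_mixture {s..<t} = ext_minkowski t - ext_minkowski s" if "s < t" for s t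
  proof -
    have "{s..<t} = {..<t} - {..<s}"
      by auto
    then show ?thesis
      using that R.finite_measure_Diff[of "{..<t}" "{..<s}"]
      by (simp add: sets measure_rot_mixture)
  qed
  show "prob_space rot_mixture \<and> sets rot_mixture = sets borel \<and>
      (\<forall>s t. s < t \<longrightarrow> measure rot_mixture {s..<t} = ext_minkowski t - ext_minkowski s)"
    using R sets R.prob_space_axioms by blast
  fix M :: "real measure"
  assume M: "prob_space M \<and> sets M = sets borel \<and>
      (\<forall>s t. s < t \<longrightarrow> measure M {s..<t} = ext_minkowski t - ext_minkowski s)"
  then interpret M: prob_space M
    by simp
  show "M = rot_mixture"
  proof (rule measure_eqI_generator_eq[where A = "\<lambda>n. {- real n..<real n}"])
    show "Int_stable (range (\<lambda>(a, b). {a..<b :: real}))"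
      by (auto simp: Int_stable_def)
    show "emeasure M X = emeasure rot_mixture X" if "X \<in> range (\<lambda>(a, b). {a..<b})" for X
    proof -
      obtain s t where X: "X = {s..<t}"
        using \<open>X \<in> _\<close> by auto
      show ?thesis
        using M R[of s t] by (cases "s < t") (simp_all add: X M.emeasure_eq_measure R.emeasure_eq_measure)
    qed
    show "sets M = sigma_sets UNIV (range (\<lambda>(a, b). {a..<b}))"
      using M by (simp add: borel_eq_atLeastLessThan)
    show "sets rot_mixture = sigma_sets UNIV (range (\<lambda>(a, b). {a..<b}))"
      by (simp add: sets borel_eq_atLeastLessThan)
    show "(\<Union>n. {- real n..<real n}) = UNIV"
    proof -
      have "x \<in> {- real (nat \<lceil>\<bar>x\<bar>\<rceil> + 1)..<real (nat \<lceil>\<bar>x\<bar>\<rceil> + 1)}" for x :: real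
        by (simp add: abs_le_iff) linarith
      then show ?thesis
        by blast
    qed
    show "emeasure M {- real n..<real n} \<noteq> \<infinity>" for n
      by simp
  qed auto
qed

lemma proj_of_real_measurable: "proj_of_real \<in> borel_measurable borel"
  by (rule borel_measurable_continuous_onI[OF continuous_proj_of_real])

lemma prob_space_ext_minkowski: "prob_space ext_minkowski_measure"
  unfolding ext_minkowski_measure_def ext_minkowski_measure_real_eq
  by (rule prob_space.prob_space_distr[OF prob_space_rot_mixture])
    (simp add: rot_mixture_def mixture_def proj_of_real_measurable)

lemma sets_ext_minkowski: "sets ext_minkowski_measure = sets borel"
  by (simp add: ext_minkowski_measure_def)

lemma integral_ext_minkowski:
  fixes f :: "proj_line \<Rightarrow> real"
  assumes f: "continuous_on UNIV f" "\<And>x. \<bar>f x\<bar> \<le> B"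
  shows "(\<integral>x. f x \<partial>ext_minkowski_measure) =
    ((\<integral>t. f (proj_of_real t) \<partial>minkowski_measure) + (\<integral>t. f (rot (proj_of_real t)) \<partial>minkowski_measure) +
     (\<integral>t. f (rot (rot (proj_of_real t))) \<partial>minkowski_measure)) / 3"
proof -
  have fm: "f \<in> borel_measurable borel" "rot \<in> borel_measurable borel"
    by (simp_all add: borel_measurable_continuous_onI f(1) continuous_rot)
  have [measurable]: "(\<lambda>t. f (proj_of_real t)) \<in> borel_measurable borel"
      "(\<lambda>t. f (rot (proj_of_real t))) \<in> borel_measurable borel"
      "(\<lambda>t. f (rot (rot (proj_of_real t)))) \<in> borel_measurable borel"
    using fm proj_of_real_measurable by measurable
  have [measurable]: "(\<lambda>t. f (proj_of_real ((real_rot ^^ i) t))) \<in> borel_measurable borel" for i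
    using measurable_compose[OF real_rot_measurable \<open>(\<lambda>t. f (proj_of_real t)) \<in> borel_measurable borel\<close>]
    by simp
  have sum: "(\<Sum>i<3. g i) = g 0 + g 1 + (g 2 :: real)" for g :: "nat \<Rightarrow> real"
    by (simp add: eval_nat_numeral)
  have "(\<integral>x. f x \<partial>ext_minkowski_measure) = (\<integral>t. f (proj_of_real t) \<partial>rot_mixture)"
    unfolding ext_minkowski_measure_def ext_minkowski_measure_real_eq
    by (rule integral_distr) (simp_all add: rot_mixture_def mixture_def proj_of_real_measurable fm)
  also have "\<dots> = (\<Sum>i<3. \<integral>t. f (proj_of_real ((real_rot ^^ i) t)) \<partial>minkowski_measure) / 3"
    unfolding rot_mixture_def
    by (subst integral_mixture[where B = B])
      (simp_all add: lessThan_empty_iff minkowski.prob_space_axioms real_rot_measurable f)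
  finally have *: "(\<integral>x. f x \<partial>ext_minkowski_measure) =
      (\<Sum>i<3. \<integral>t. f (proj_of_real ((real_rot ^^ i) t)) \<partial>minkowski_measure) / 3" .
  have 1: "(\<integral>t. f (proj_of_real ((real_rot ^^ 1) t)) \<partial>minkowski_measure) =
      (\<integral>t. f (rot (proj_of_real t)) \<partial>minkowski_measure)"
  proof (rule integral_cong_AE)
    show "AE t in minkowski_measure. f (proj_of_real ((real_rot ^^ 1) t)) = f (rot (proj_of_real t))"
      using AE_minkowski[of 0] by eventually_elim (simp add: rot_proj_of_real real_rot_def)
  qed measurable
  have 2: "(\<integral>t. f (proj_of_real ((real_rot ^^ 2) t)) \<partial>minkowski_measure) =
      (\<integral>t. f (rot (rot (proj_of_real t))) \<partial>minkowski_measure)"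
  proof (rule integral_cong_AE)
    show "AE t in minkowski_measure. f (proj_of_real ((real_rot ^^ 2) t)) = f (rot (rot (proj_of_real t)))"
      using AE_minkowski[of 0]
      by eventually_elim (simp add: rot_proj_of_real real_rot_def numeral_2_eq_2 field_simps)
  qed measurable
  show ?thesis
    unfolding * sum 1 2 by simp
qed


section \<open>The averaging operator and its stationary measure\<close>

definition walk_average :: "(proj_line \<Rightarrow> real) \<Rightarrow> proj_line \<Rightarrow> real" where
  "walk_average f x = (f (act farey_a x) + f (act farey_b x) + f (act farey_c x)) / 3"

lemma walk_average_diff:
  "\<bar>walk_average f x - walk_average f y\<bar> \<le>
    (\<bar>f (act farey_a x) - f (act farey_a y)\<bar> + \<bar>f (act farey_b x) - f (act farey_b y)\<bar> +
     \<bar>f (act farey_c x) - f (act farey_c y)\<bar>) / 3"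
proof -
  have "\<bar>u + v + w - (u' + v' + w')\<bar> \<le> \<bar>u - u'\<bar> + \<bar>v - v'\<bar> + \<bar>w - w'\<bar>" for u v w u' v' w' :: real
    by linarith
  then show ?thesis
    by (simp add: walk_average_def flip: diff_divide_distrib)
qed

lemma continuous_walk_average:
  assumes "continuous_on UNIV f"
  shows "continuous_on UNIV (walk_average f)"
proof -
  have "continuous_on UNIV (\<lambda>x. f (act A x))" if "det A = 1" for A
    using continuous_on_compose2[OF assms continuous_act[OF that]] by simp
  then show ?thesis
    unfolding walk_average_def[abs_def] using det_farey by (intro continuous_intros) auto
qed

lemma walk_average_bounded:
  assumes "\<And>x. \<bar>f x\<bar> \<le> B"
  shows "\<bar>walk_average f x\<bar> \<le> B"
  using assms[of "act farey_a x"] assms[of "act farey_b x"] assms[of "act farey_c x"]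
  by (simp add: walk_average_def abs_le_iff)

text \<open>Write \<open>K g\<close> for the integral of \<open>g\<close> over the arc \<open>[0, 1]\<close> against the Minkowski measure, and \<open>L g\<close>, \<open>R g\<close> for
  the integrals over its two halves against the images of that measure, so that \<open>K g = (L g + R g) / 2\<close>.
  The integral of the average consists of nine terms, one for each generator and each arc. Six of
  them, where the generator does not belong to the arc, are of the form \<open>L g\<close> or \<open>R g\<close> and together
  contribute twice the integral of \<open>f\<close> over the three arcs. In the other three the generator opens up
  its own arc; splitting that arc into halves turns each half into a full arc, and these terms
  contribute the same integral once more.\<close>

lemma integral_walk_average:
  assumes f: "continuous_on UNIV f" "\<And>x. \<bar>f x\<bar> \<le> B"
  shows "(\<integral>x. walk_average f x \<partial>ext_minkowski_measure) = (\<integral>x. f x \<partial>ext_minkowski_measure)"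
proof -
  define K where "K = (\<lambda>g :: proj_line \<Rightarrow> real. \<integral>t. g (proj_of_real t) \<partial>minkowski_measure)"
  \<comment> \<open>The bound \<open>B\<close> only serves integrability.\<close>
  define good where "good = (\<lambda>g :: proj_line \<Rightarrow> real. continuous_on UNIV g \<and> (\<forall>x. \<bar>g x\<bar> \<le> B))"
  have ext: "(\<integral>x. g x \<partial>ext_minkowski_measure) = (K g + K (\<lambda>x. g (rot x)) + K (\<lambda>x. g (rot (rot x)))) / 3"
    if "good g" for g
    using integral_ext_minkowski[of g B] that by (simp add: good_def K_def)
  have good_act: "good (\<lambda>x. g (act A x))" if "good g" "det A = 1" for g A
    using that continuous_on_compose2[OF _ continuous_act[of A], of UNIV g] by (simp add: good_def)
  have good_rot: "good (\<lambda>x. g (rot x))" and good_flip: "good (\<lambda>x. g (side_flip x))" if "good g" for g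
    unfolding rot_def side_flip_def using that by (auto intro!: good_act simp: det_mat2 det_farey)
  have meas: "(\<lambda>t. g (proj_of_real t)) \<in> borel_measurable borel" if "good g" for g
    using that by (intro measurable_compose[OF proj_of_real_measurable] borel_measurable_continuous_onI)
      (simp add: good_def)
  define L where "L = (\<lambda>g :: proj_line \<Rightarrow> real. \<integral>t. g (proj_of_real (farey_left t)) \<partial>minkowski_measure)"
  define R where "R = (\<lambda>g :: proj_line \<Rightarrow> real. \<integral>t. g (proj_of_real (farey_right t)) \<partial>minkowski_measure)"
  have split: "K g = (L g + R g) / 2" if "good g" for g
    unfolding K_def L_def R_def
    by (rule integral_minkowski_self_similar[where B = B]) (use that meas in \<open>auto simp: good_def\<close>)
  have left: "K (\<lambda>x. g (side_flip (rot x))) = L g" if "good g" for g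
    unfolding K_def L_def
  proof (rule integral_cong_AE)
    show "AE t in minkowski_measure. g (side_flip (rot (proj_of_real t))) = g (proj_of_real (farey_left t))"
      using AE_minkowski[of 0] by eventually_elim (simp add: side_flip_rot_left)
    show "(\<lambda>t. g (proj_of_real (farey_left t))) \<in> borel_measurable minkowski_measure"
      using measurable_compose[OF farey_left_measurable meas[OF that]] by simp
    show "(\<lambda>t. g (side_flip (rot (proj_of_real t)))) \<in> borel_measurable minkowski_measure"
      using meas[OF good_rot[OF good_flip[OF that]]] by simp
  qed
  have right: "K (\<lambda>x. g (side_flip (rot (rot x)))) = R g" if "good g" for g
    unfolding K_def R_def
  proof (rule integral_cong_AE)
    show "AE t in minkowski_measure. g (side_flip (rot (rot (proj_of_real t)))) = g (proj_of_real (farey_right t))"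
      using AE_minkowski[of 0] by eventually_elim (simp add: side_flip_rot_right)
    show "(\<lambda>t. g (proj_of_real (farey_right t))) \<in> borel_measurable minkowski_measure"
      using measurable_compose[OF farey_right_measurable meas[OF that]] by simp
    show "(\<lambda>t. g (side_flip (rot (rot (proj_of_real t))))) \<in> borel_measurable minkowski_measure"
      using meas[OF good_rot[OF good_rot[OF good_flip[OF that]]]] by simp
  qed
  have flip: "K (\<lambda>x. g (side_flip x)) = (K (\<lambda>x. g (rot x)) + K (\<lambda>x. g (rot (rot x)))) / 2" if "good g" for g
    using split[OF good_flip[OF that]] left[OF good_flip[OF that]] right[OF good_flip[OF that]] by simp
  have lin: "K (\<lambda>x. (g1 x + g2 x + g3 x) / 3) = (K g1 + K g2 + K g3) / 3" if "good g1" "good g2" "good g3" for g1 g2 g3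
  proof -
    have "integrable minkowski_measure (\<lambda>t. g (proj_of_real t))" if "good g" for g
      using that meas[OF that] by (intro minkowski.integrable_const_bound[where B = B]) (auto simp: good_def)
    then show ?thesis
      using that by (simp add: K_def)
  qed
  have "good f"
    using f by (simp add: good_def)
  then have g: "good (\<lambda>x. f (rot x))" "good (\<lambda>x. f (rot (rot x)))"
    "good (walk_average f)"
    using good_rot[of f] good_rot[of "\<lambda>x. f (rot x)"] continuous_walk_average[of f] walk_average_bounded[of f]
    by (simp_all add: good_def)
  note g = \<open>good f\<close> g
  note g' = good_flip[OF g(1)] good_flip[OF g(2)] good_flip[OF g(3)]
  note g'' = g'[THEN good_rot]
  note all_good = g g' g'' g''[THEN good_rot]
  have "(\<integral>x. walk_average f x \<partial>ext_minkowski_measure) =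
     (K (walk_average f) + K (\<lambda>x. walk_average f (rot x)) + K (\<lambda>x. walk_average f (rot (rot x)))) / 3"
    by (rule ext) (rule g)
  also have "\<dots> = (2 * ((L f + R f) / 2 + (L (\<lambda>x. f (rot x)) + R (\<lambda>x. f (rot x))) / 2 +
       (L (\<lambda>x. f (rot (rot x))) + R (\<lambda>x. f (rot (rot x)))) / 2) +
      (K (\<lambda>x. f (side_flip x)) + K (\<lambda>x. f (rot (side_flip x))) + K (\<lambda>x. f (rot (rot (side_flip x)))))) / 9"
    unfolding walk_average_def act_farey_a act_farey_b act_farey_c
    by (simp add: lin all_good left[OF g(1)] left[OF g(2)] left[OF g(3)]
        right[OF g(1)] right[OF g(2)] right[OF g(3)]) (simp add: field_simps)
  also have "\<dots> = (2 * (K f + K (\<lambda>x. f (rot x)) + K (\<lambda>x. f (rot (rot x)))) +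
     (K f + K (\<lambda>x. f (rot x)) + K (\<lambda>x. f (rot (rot x))))) / 9"
    using flip[OF g(1)] flip[OF g(2)] flip[OF g(3)]
    unfolding split[OF g(1), symmetric] split[OF g(2), symmetric] split[OF g(3), symmetric] by simp
  also have "\<dots> = (\<integral>x. f x \<partial>ext_minkowski_measure)"
    using ext[OF g(1)] by simp
  finally show ?thesis .
qed

section \<open>Contraction\<close>

text \<open>Arcs of level \<open>k + 1\<close> are the rotated Farey intervals of level \<open>k\<close>; the only arc of level \<open>0\<close> is the
  whole projective line.\<close>

fun same_arc :: "nat \<Rightarrow> proj_line \<Rightarrow> proj_line \<Rightarrow> bool" where
  "same_arc 0 x y \<longleftrightarrow> True"
| "same_arc (Suc k) x y \<longleftrightarrow> (\<exists>i t s. same_farey_interval k t s \<and>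
     x = (rot ^^ i) (proj_of_real t) \<and> y = (rot ^^ i) (proj_of_real s))"

lemma same_arc_rot: "same_arc k x y \<Longrightarrow> same_arc k ((rot ^^ i) x) ((rot ^^ i) y)"
proof (cases k)
  case (Suc l)
  assume "same_arc k x y"
  then obtain j t s where "same_farey_interval l t s"
      "x = (rot ^^ j) (proj_of_real t)" "y = (rot ^^ j) (proj_of_real s)"
    by (auto simp: Suc)
  then show ?thesis
    unfolding Suc same_arc.simps by (intro exI[of _ "i + j"] exI[of _ t] exI[of _ s]) (simp add: funpow_add)
qed simp

lemma same_arc_proj_of_real: "same_farey_interval k t s \<Longrightarrow> same_arc (Suc k) (proj_of_real t) (proj_of_real s)"
  unfolding same_arc.simps by (intro exI[of _ 0] exI[of _ t] exI[of _ s]) simp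

text \<open>Lipschitz continuity with constant \<open>C\<close> for the distance \<open>(3/4)\<^sup>k\<close>, up to an additive error. The error is
  what allows every continuous function, and it is not increased by averaging. The base \<open>3/4\<close> lies
  between \<open>1/2\<close> and \<open>1\<close>; for such \<open>\<rho>\<close> the factor \<open>(1 / \<rho> + 2 * \<rho>) / 3\<close> is smaller than \<open>1\<close>.\<close>

definition arc_lipschitz :: "real \<Rightarrow> real \<Rightarrow> (proj_line \<Rightarrow> real) \<Rightarrow> bool" where
  "arc_lipschitz \<epsilon> C f \<longleftrightarrow> (\<forall>k x y. same_arc k x y \<longrightarrow> \<bar>f x - f y\<bar> \<le> \<epsilon> + C * (3/4) ^ k)"

lemma arc_lipschitz_rot: "arc_lipschitz \<epsilon> C f \<Longrightarrow> arc_lipschitz \<epsilon> C (\<lambda>x. f (rot x))"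
  using same_arc_rot[where i = 1] by (auto simp: arc_lipschitz_def)

text \<open>Conjugation by \<open>rot\<close> permutes the three generators. Statements about points of a common arc can
  therefore be reduced to the arc \<open>[0, 1]\<close>.\<close>

lemma walk_average_rot: "walk_average (\<lambda>x. f (rot x)) x = walk_average f (rot x)"
  by (simp add: walk_average_def act_farey_a act_farey_b act_farey_c)

text \<open>The generator \<open>c\<close> strips the first branch from both points and lowers the level by one. The other two
  generators prepend a branch and raise the level by one.\<close>

lemma walk_average_same_interval:
  assumes f: "arc_lipschitz \<epsilon> C f" and I: "same_farey_interval k t s"
  shows "\<bar>walk_average f (proj_of_real t) - walk_average f (proj_of_real s)\<bar> \<le> \<epsilon> + 17/18 * C * (3/4) ^ Suc k"
proof -
  let ?t = "proj_of_real t" and ?s = "proj_of_real s"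
  have r: "0 \<le> t" "t \<le> 1" "0 \<le> s" "s \<le> 1"
    using same_farey_interval_range[OF I] by auto
  have "same_arc k (side_flip ?t) (side_flip ?s)"
    using I
  proof cases
    case (left l u v)
    then show ?thesis
      using same_farey_interval_range[OF left(4)] same_arc_rot[OF same_arc_proj_of_real[OF left(4)], of 1]
      by (simp add: side_flip_left del: same_arc.simps)
  next
    case (right l u v)
    then show ?thesis
      using same_farey_interval_range[OF right(4)] same_arc_rot[OF same_arc_proj_of_real[OF right(4)], of 2]
      by (simp add: side_flip_right numeral_2_eq_2 del: same_arc.simps)
  qed simp
  then have c: "\<bar>f (act farey_c ?t) - f (act farey_c ?s)\<bar> \<le> \<epsilon> + C * (3/4) ^ k"
    using f by (simp add: arc_lipschitz_def act_farey_c)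
  have "same_arc (Suc (Suc k)) (rot (proj_of_real (farey_right t))) (rot (proj_of_real (farey_right s)))"
    using same_arc_rot[OF same_arc_proj_of_real[OF same_farey_interval.right[OF I]], of 1]
    by (simp del: same_arc.simps)
  then have a: "\<bar>f (act farey_a ?t) - f (act farey_a ?s)\<bar> \<le> \<epsilon> + C * (3/4) ^ Suc (Suc k)"
    using f r by (simp add: arc_lipschitz_def act_farey_a side_flip_rot_right del: same_arc.simps power_Suc)
  have "same_arc (Suc (Suc k)) (rot (rot (proj_of_real (farey_left t)))) (rot (rot (proj_of_real (farey_left s))))"
    using same_arc_rot[OF same_arc_proj_of_real[OF same_farey_interval.left[OF I]], of 2]
    by (simp add: numeral_2_eq_2 del: same_arc.simps)
  then have b: "\<bar>f (act farey_b ?t) - f (act farey_b ?s)\<bar> \<le> \<epsilon> + C * (3/4) ^ Suc (Suc k)"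
    using f r by (simp add: arc_lipschitz_def act_farey_b side_flip_rot_left del: same_arc.simps power_Suc)
  have "\<bar>walk_average f ?t - walk_average f ?s\<bar> \<le>
      (\<bar>f (act farey_a ?t) - f (act farey_a ?s)\<bar> + \<bar>f (act farey_b ?t) - f (act farey_b ?s)\<bar> +
       \<bar>f (act farey_c ?t) - f (act farey_c ?s)\<bar>) / 3"
    by (rule walk_average_diff)
  also have "\<dots> \<le> (\<epsilon> + C * (3/4) ^ Suc (Suc k) + (\<epsilon> + C * (3/4) ^ Suc (Suc k)) + (\<epsilon> + C * (3/4) ^ k)) / 3"
    using a b c by (intro divide_right_mono add_mono) simp_all
  also have "\<dots> = \<epsilon> + 17/18 * C * (3/4) ^ Suc k"
    by (simp add: field_simps)
  finally show ?thesis .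
qed

lemma walk_average_same_interval_rot:
  assumes "arc_lipschitz \<epsilon> C f" "same_farey_interval k t s"
  shows "\<bar>walk_average f ((rot ^^ i) (proj_of_real t)) - walk_average f ((rot ^^ i) (proj_of_real s))\<bar>
    \<le> \<epsilon> + 17/18 * C * (3/4) ^ Suc k"
  using assms(1)
proof (induction i arbitrary: f)
  case 0
  then show ?case
    using walk_average_same_interval[OF 0 assms(2)] by simp
next
  case (Suc i)
  show ?case
    using Suc.IH[OF arc_lipschitz_rot[OF Suc.prems]] by (simp add: walk_average_rot)
qed

text \<open>One generator that brings the points together is enough: the other two terms are estimated by
  the total oscillation, which gives the factor \<open>(2 + 3/4) / 3 = 11/12 \<le> 17/18\<close>.\<close>

lemma walk_average_distinct_arcs:
  assumes f: "arc_lipschitz \<epsilon> C f" "0 \<le> C"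
    and g: "same_arc 1 (act g x) (act g y)" "g \<in> {farey_a, farey_b, farey_c}"
  shows "\<bar>walk_average f x - walk_average f y\<bar> \<le> \<epsilon> + 17/18 * C"
proof -
  have 0: "\<bar>f u - f v\<bar> \<le> \<epsilon> + C" for u v
    using f(1) unfolding arc_lipschitz_def by (metis mult.right_neutral power_0 same_arc.simps(1))
  have "\<bar>f (act g x) - f (act g y)\<bar> \<le> \<epsilon> + C * (3/4)"
    using f(1) g(1) unfolding arc_lipschitz_def by (metis power_one_right)
  then have "\<bar>f (act farey_a x) - f (act farey_a y)\<bar> + \<bar>f (act farey_b x) - f (act farey_b y)\<bar> +
      \<bar>f (act farey_c x) - f (act farey_c y)\<bar> \<le> 3 * \<epsilon> + 11/4 * C"
    using g(2) 0[of "act farey_a x" "act farey_a y"] 0[of "act farey_b x" "act farey_b y"]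
      0[of "act farey_c x" "act farey_c y"] by auto
  moreover have "\<bar>walk_average f x - walk_average f y\<bar> \<le>
      (\<bar>f (act farey_a x) - f (act farey_a y)\<bar> + \<bar>f (act farey_b x) - f (act farey_b y)\<bar> +
       \<bar>f (act farey_c x) - f (act farey_c y)\<bar>) / 3"
    by (rule walk_average_diff)
  ultimately show ?thesis
    using f(2) by simp
qed

text \<open>If the points lie in different arcs, the generator of the third arc maps both into that arc.\<close>

lemma ex_generator_same_arc:
  assumes "i < 3" "j < 3" "i \<noteq> j" and "0 \<le> t" "t \<le> 1" "0 \<le> s" "s \<le> 1"
    and x: "x = (rot ^^ i) (proj_of_real t)" and y: "y = (rot ^^ j) (proj_of_real s)"
  shows "\<exists>g\<in>{farey_a, farey_b, farey_c}. same_arc 1 (act g x) (act g y)"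
proof -
  have *: "same_arc 1 ((rot ^^ l) (proj_of_real u)) ((rot ^^ l) (proj_of_real v))"
    if "0 \<le> u \<and> u \<le> 1" "0 \<le> v \<and> v \<le> 1" for l u v
    using same_farey_interval.unit[of u v] that by auto
  have r: "0 \<le> farey_left t \<and> farey_left t \<le> 1" "0 \<le> farey_right t \<and> farey_right t \<le> 1"
    "0 \<le> farey_left s \<and> farey_left s \<le> 1" "0 \<le> farey_right s \<and> farey_right s \<le> 1"
    using assms farey_left_range[of t] farey_left_range[of s] farey_right_range[of t] farey_right_range[of s]
    by auto
  consider "i = 0" "j = 1" | "i = 1" "j = 0" | "i = 0" "j = 2" | "i = 2" "j = 0" | "i = 1" "j = 2" | "i = 2" "j = 1"
    using assms(1-3) by linarith
  then show ?thesis
  proof cases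
    case 1
    have "same_arc 1 (act farey_b x) (act farey_b y)"
      using *[OF r(1) r(4), of 2] assms by (simp add: x y 1 act_farey_b side_flip_rot_left side_flip_rot_right numeral_2_eq_2)
    then show ?thesis by blast
  next
    case 2
    have "same_arc 1 (act farey_b x) (act farey_b y)"
      using *[OF r(2) r(3), of 2] assms by (simp add: x y 2 act_farey_b side_flip_rot_left side_flip_rot_right numeral_2_eq_2)
    then show ?thesis by blast
  next
    case 3
    have "same_arc 1 (act farey_a x) (act farey_a y)"
      using *[OF r(2) r(3), of 1] assms by (simp add: x y 3 act_farey_a side_flip_rot_left side_flip_rot_right numeral_2_eq_2)
    then show ?thesis by blast
  next
    case 4
    have "same_arc 1 (act farey_a x) (act farey_a y)"
      using *[OF r(1) r(4), of 1] assms by (simp add: x y 4 act_farey_a side_flip_rot_left side_flip_rot_right numeral_2_eq_2)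
    then show ?thesis by blast
  next
    case 5
    have "same_arc 1 (act farey_c x) (act farey_c y)"
      using *[OF r(1) r(4), of 0] assms by (simp add: x y 5 act_farey_c side_flip_rot_left side_flip_rot_right numeral_2_eq_2)
    then show ?thesis by blast
  next
    case 6
    have "same_arc 1 (act farey_c x) (act farey_c y)"
      using *[OF r(2) r(3), of 0] assms by (simp add: x y 6 act_farey_c side_flip_rot_left side_flip_rot_right numeral_2_eq_2)
    then show ?thesis by blast
  qed
qed

lemma arc_lipschitz_walk_average:
  assumes f: "arc_lipschitz \<epsilon> C f" "0 \<le> C"
  shows "arc_lipschitz \<epsilon> (17/18 * C) (walk_average f)"
  unfolding arc_lipschitz_def
proof (intro allI impI)
  fix k x y assume "same_arc k x y"
  show "\<bar>walk_average f x - walk_average f y\<bar> \<le> \<epsilon> + 17/18 * C * (3/4) ^ k"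
  proof (cases k)
    case (Suc l)
    with \<open>same_arc k x y\<close> show ?thesis
      using walk_average_same_interval_rot[OF f(1)] by auto
  next
    case 0
    obtain i t where x: "i < 3" "0 \<le> t" "t \<le> 1" "x = (rot ^^ i) (proj_of_real t)"
      by (rule proj_line_rot_cases)
    obtain j s where y: "j < 3" "0 \<le> s" "s \<le> 1" "y = (rot ^^ j) (proj_of_real s)"
      by (rule proj_line_rot_cases)
    show ?thesis
    proof (cases "i = j")
      case True
      have "\<bar>walk_average f x - walk_average f y\<bar> \<le> \<epsilon> + 17/18 * C * (3/4)"
        using walk_average_same_interval_rot[OF f(1) same_farey_interval.unit, of t s i] x y True by simp
      then show ?thesis
        using f(2) by (simp add: 0)
    next
      case False
      then show ?thesis
        using ex_generator_same_arc[OF x(1) y(1) False x(2,3) y(2,3) x(4) y(4)]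
          walk_average_distinct_arcs[OF f] by (simp only: 0 power_0 mult_1_right) blast
    qed
  qed
qed

lemma arc_lipschitz_iterate:
  assumes "arc_lipschitz \<epsilon> C f" "0 \<le> C"
  shows "arc_lipschitz \<epsilon> ((17/18) ^ n * C) ((walk_average ^^ n) f)"
  by (induction n) (use assms arc_lipschitz_walk_average in \<open>auto simp: mult.assoc\<close>)

lemma rot_power_mod: "(rot ^^ i) x = (rot ^^ (i mod 3)) x"
  by (rule funpow_mod_eq[symmetric]) (simp add: eval_nat_numeral)

text \<open>The projective line is the union of three continuous images of \<open>[0, 1]\<close>. Both claims therefore
  reduce to the boundedness and uniform continuity of continuous functions on \<open>[0, 1]\<close>.\<close>

lemma proj_line_function_bounded_uniform:
  fixes f :: "proj_line \<Rightarrow> real"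
  assumes f: "continuous_on UNIV f"
  shows "\<exists>B. \<forall>x. \<bar>f x\<bar> \<le> B"
    and "\<epsilon> > 0 \<Longrightarrow> \<exists>N. \<forall>k\<ge>N. \<forall>x y. same_arc (Suc k) x y \<longrightarrow> \<bar>f x - f y\<bar> \<le> \<epsilon>"
proof -
  have rot: "continuous_on UNIV (rot ^^ i)" for i
  proof (induction i)
    case (Suc i)
    have "continuous_on UNIV (\<lambda>x. rot ((rot ^^ i) x))"
      by (rule continuous_on_compose2[OF continuous_rot Suc.IH]) simp
    then show ?case
      by (simp add: o_def)
  qed (simp add: id_def)
  define h where "h = (\<lambda>i t. f ((rot ^^ i) (proj_of_real t)))"
  have h: "continuous_on {0..1} (h i)" for i
    unfolding h_def
    by (intro continuous_on_compose2[OF f] continuous_on_compose2[OF rot]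
        continuous_on_subset[OF continuous_proj_of_real]) auto
  show "\<exists>B. \<forall>x. \<bar>f x\<bar> \<le> B"
  proof -
    have "bounded (\<Union>i\<in>{..<3}. h i ` {0..1})"
      by (intro bounded_UN finite_lessThan ballI compact_imp_bounded compact_continuous_image h) simp
    then obtain B where B: "\<And>i t. i < 3 \<Longrightarrow> 0 \<le> t \<Longrightarrow> t \<le> 1 \<Longrightarrow> \<bar>h i t\<bar> \<le> B"
      by (fastforce simp: bounded_real)
    have "\<bar>f x\<bar> \<le> B" for x
    proof -
      obtain i t where "i < 3" "0 \<le> t" "t \<le> 1" "x = (rot ^^ i) (proj_of_real t)"
        by (rule proj_line_rot_cases)
      then show ?thesis
        using B[of i t] by (simp add: h_def)
    qed
    then show ?thesis
      by blast
  qed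
  show "\<exists>N. \<forall>k\<ge>N. \<forall>x y. same_arc (Suc k) x y \<longrightarrow> \<bar>f x - f y\<bar> \<le> \<epsilon>" if "\<epsilon> > 0"
  proof -
    have "\<exists>d>0. \<forall>t\<in>{0..1}. \<forall>s\<in>{0..1}. dist s t < d \<longrightarrow> dist (h i s) (h i t) < \<epsilon>" for i
      using compact_uniformly_continuous[OF h, of i] that by (auto simp: uniformly_continuous_on_def)
    then obtain d where d: "\<And>i. d i > 0"
        "\<And>i t s. t \<in> {0..1} \<Longrightarrow> s \<in> {0..1} \<Longrightarrow> dist s t < d i \<Longrightarrow> dist (h i s) (h i t) < \<epsilon>"
      by metis
    define e where "e = Min (d ` {..<3})"
    have "e > 0" "\<And>i. i < 3 \<Longrightarrow> e \<le> d i"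
      using d(1) by (auto simp: e_def lessThan_empty_iff)
    then obtain N :: nat where N: "1 / (real N + 1) < e"
      using reals_Archimedean[of e] by (auto simp: inverse_eq_divide add.commute)
    have "\<bar>f x - f y\<bar> \<le> \<epsilon>" if k: "k \<ge> N" and arc: "same_arc (Suc k) x y" for k x y
    proof -
      obtain i t s where I: "same_farey_interval k t s" "x = (rot ^^ i) (proj_of_real t)" "y = (rot ^^ i) (proj_of_real s)"
        using arc by auto
      define j where "j = i mod 3"
      have "\<bar>s - t\<bar> \<le> 1 / (real k + 1)"
        using farey_interval_length[OF I(1)] by (simp add: abs_minus_commute)
      also have "\<dots> \<le> 1 / (real N + 1)"
        using k by (simp add: frac_le)
      also have "\<dots> < d j"
        using N \<open>\<And>i. i < 3 \<Longrightarrow> e \<le> d i\<close>[of j] by (simp add: j_def)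
      finally have "dist (h j s) (h j t) < \<epsilon>"
        using same_farey_interval_range[OF I(1)] by (intro d(2)) (simp_all add: dist_real_def)
      then show ?thesis
        using I(2,3) rot_power_mod[of i] by (simp add: h_def j_def dist_real_def abs_minus_commute)
    qed
    then show ?thesis
      by blast
  qed
qed

text \<open>At small depth the bound comes from boundedness with a large constant, at large depth from
  uniform continuity.\<close>

lemma continuous_arc_lipschitz:
  assumes f: "continuous_on UNIV f" and "\<epsilon> > 0"
  shows "\<exists>C\<ge>0. arc_lipschitz \<epsilon> C f"
proof -
  obtain B where B: "\<And>x. \<bar>f x\<bar> \<le> B"
    using proj_line_function_bounded_uniform(1)[OF f] by blast
  obtain N where N: "\<And>k x y. k \<ge> N \<Longrightarrow> same_arc (Suc k) x y \<Longrightarrow> \<bar>f x - f y\<bar> \<le> \<epsilon>"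
    using proj_line_function_bounded_uniform(2)[OF f \<open>\<epsilon> > 0\<close>] by blast
  define C where "C = 2 * B / (3/4) ^ Suc N"
  have "0 \<le> B"
    using B[of undefined] by linarith
  then have "0 \<le> C"
    by (simp add: C_def)
  moreover have "\<bar>f x - f y\<bar> \<le> \<epsilon> + C * (3/4) ^ k" if "same_arc k x y" for k x y
  proof (cases "k \<le> Suc N")
    case True
    \<comment> \<open>Here \<open>C\<close> is chosen so that the bound is \<open>2 * B\<close> at depth \<open>Suc N\<close> and larger before.\<close>
    have "\<bar>f x - f y\<bar> \<le> 2 * B"
      using B[of x] B[of y] by linarith
    also have "\<dots> = C * (3/4) ^ Suc N"
      by (simp add: C_def)
    also have "\<dots> \<le> C * (3/4) ^ k"
      using True \<open>0 \<le> C\<close> by (intro mult_left_mono power_decreasing) auto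
    finally show ?thesis
      using \<open>\<epsilon> > 0\<close> by simp
  next
    case False
    then obtain l where "k = Suc l" "N \<le> l"
      by (cases k) auto
    then have "\<bar>f x - f y\<bar> \<le> \<epsilon>"
      using N that by blast
    then show ?thesis
      using \<open>0 \<le> C\<close> by (simp add: add_increasing2)
  qed
  ultimately show ?thesis
    by (auto simp: arc_lipschitz_def)
qed


section \<open>The law of the random walk\<close>

lemma measurable_discrete:
  assumes "sets N = Pow C" "\<And>g. g \<in> C \<Longrightarrow> f g \<in> space L"
  shows "f \<in> N \<rightarrow>\<^sub>M L"
proof -
  have "f \<in> count_space C \<rightarrow>\<^sub>M L"
    using assms(2) by simp
  then show ?thesis
    using measurable_cong_sets[of N "count_space C" L L] assms(1) by simp
qed

lemma integral_uniform_three_points: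
  fixes h :: "'a \<Rightarrow> real"
  assumes "prob_space M" "sets M = Pow C" "{x, y, z} \<subseteq> C" "x \<noteq> y" "x \<noteq> z" "y \<noteq> z"
    and m: "measure M {x} = 1/3" "measure M {y} = 1/3" "measure M {z} = 1/3"
  shows "(\<integral>g. h g \<partial>M) = (h x + h y + h z) / 3"
proof -
  interpret prob_space M by fact
  have s: "{x} \<in> sets M" "{y} \<in> sets M" "{z} \<in> sets M" "{x, y, z} \<in> sets M"
    using assms(2,3) by auto
  have "measure M {x, y, z} = (\<Sum>g\<in>{x, y, z}. measure M {g})"
    using s by (intro finite_measure_eq_sum_singleton) auto
  then have "measure M {x, y, z} = 1"
    using assms by simp
  then have "AE g in M. g \<in> {x, y, z}"
    by (rule AE_prob_1)
  then have "AE g in M. h g = h x * indicator {x} g + h y * indicator {y} g + h z * indicator {z} g"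
    by eventually_elim (use assms(4-6) in \<open>auto simp: indicator_def\<close>)
  moreover have "h \<in> borel_measurable M"
    using assms(2) by (rule measurable_discrete) simp
  ultimately have "(\<integral>g. h g \<partial>M) =
      (\<integral>g. h x * indicator {x} g + h y * indicator {y} g + h z * indicator {z} g \<partial>M)"
    using s by (intro integral_cong_AE) auto
  also have "\<dots> = h x * measure M {x} + h y * measure M {y} + h z * measure M {z}"
    using s sets.sets_into_space[OF s(4)] by (simp add: Int_absorb2 emeasure_eq_measure)
  finally show ?thesis
    using m by simp
qed

context
  fixes \<mu> :: "(real^2^2) set measure" and \<pi> :: "proj_line measure"
  assumes \<mu>: "prob_space \<mu>" "sets \<mu> = Pow (carrier farey_group)"
    and atoms: "measure \<mu> {psl_class farey_a} = 1/3" "measure \<mu> {psl_class farey_b} = 1/3"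
      "measure \<mu> {psl_class farey_c} = 1/3"
    and \<pi>: "prob_space \<pi>" "sets \<pi> = sets borel"
begin

lemma convolution_power_family:
  "prob_space (convolution_power farey_group \<mu> n) \<and>
   sets (convolution_power farey_group \<mu> n) = Pow (carrier farey_group)"
proof (induction n)
  case 0
  then show ?case
    by (simp add: prob_space_return farey_group_one_closed)
next
  case (Suc n)
  then show ?case
    unfolding convolution_power.simps group_convolution_def
    using \<mu> countable_farey_group
    by (auto intro!: prob_space_family[where C = "carrier farey_group"]
        measurable_discrete[where C = "carrier farey_group"] simp: farey_group_mult_closed)
qed

lemma integral_step: "(\<integral>g. h g \<partial>\<mu>) = (h (psl_class farey_a) + h (psl_class farey_b) + h (psl_class farey_c)) / (3 :: real)"
  by (rule integral_uniform_three_points[OF \<mu> _ farey_generators_distinct atoms])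
    (simp add: farey_group_generators)

lemma
  fixes f :: "proj_line \<Rightarrow> real"
  shows prob_space_act_convolution: "prob_space (act_convolution (convolution_power farey_group \<mu> n) \<pi>)"
    and sets_act_convolution: "sets (act_convolution (convolution_power farey_group \<mu> n) \<pi>) = sets borel"
    and integral_act_convolution: "\<lbrakk>f \<in> borel_measurable borel; \<And>x. \<bar>f x\<bar> \<le> B\<rbrakk> \<Longrightarrow>
      (\<integral>x. f x \<partial>act_convolution (convolution_power farey_group \<mu> n) \<pi>) =
      (\<integral>g. \<integral>x. f (proj_act g x) \<partial>\<pi> \<partial>convolution_power farey_group \<mu> n)"
proof -
  have m: "proj_act g \<in> borel_measurable \<pi>" if "g \<in> carrier farey_group" for g
    using proj_act_measurable[OF that] \<pi>(2) by (simp cong: measurable_cong_sets)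
  show "prob_space (act_convolution (convolution_power farey_group \<mu> n) \<pi>)"
    unfolding act_convolution_def using convolution_power_family \<pi>(1) countable_farey_group m
    by (intro prob_space_family) auto
  show "(\<integral>x. f x \<partial>act_convolution (convolution_power farey_group \<mu> n) \<pi>) =
      (\<integral>g. \<integral>x. f (proj_act g x) \<partial>\<pi> \<partial>convolution_power farey_group \<mu> n)"
    if "f \<in> borel_measurable borel" "\<And>x. \<bar>f x\<bar> \<le> B"
    unfolding act_convolution_def using convolution_power_family \<pi>(1) countable_farey_group m that
    by (intro integral_family) auto
qed (simp add: act_convolution_def)

text \<open>The first factor of the convolution is the step applied last. Conditioning on it turns \<open>f\<close> into
  \<open>walk_average f\<close> and leaves a convolution power with one factor less.\<close>

lemma integral_act_convolution_power:
  fixes f :: "proj_line \<Rightarrow> real"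
  assumes "continuous_on UNIV f" "\<And>x. \<bar>f x\<bar> \<le> B"
  shows "(\<integral>x. f x \<partial>act_convolution (convolution_power farey_group \<mu> n) \<pi>) = (\<integral>x. (walk_average ^^ n) f x \<partial>\<pi>)"
  using assms
proof (induction n arbitrary: f)
  case 0
  have "(\<lambda>g. \<integral>x. f (proj_act g x) \<partial>\<pi>) \<in> borel_measurable (count_space (carrier farey_group))"
    by simp
  then show ?case
    using 0 by (subst integral_act_convolution[where B = B])
      (simp_all add: borel_measurable_continuous_onI integral_return farey_group_one_closed proj_act_one)
next
  case (Suc n)
  let ?\<nu> = "convolution_power farey_group \<mu> n" and ?G = "carrier farey_group"
  interpret \<nu>: prob_space ?\<nu>
    using convolution_power_family by blast
  interpret \<pi>: prob_space \<pi>
    by (rule \<pi>)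
  have fm: "f \<in> borel_measurable borel"
    using Suc.prems(1) by (rule borel_measurable_continuous_onI)
  have bound: "\<bar>\<integral>x. f (proj_act g x) \<partial>\<pi>\<bar> \<le> B" for g
  proof -
    \<comment> \<open>For \<open>g\<close> outside the group the integrand need not be measurable; the integral is then \<open>0\<close>.\<close>
    have "0 \<le> B"
      using order_trans[OF abs_ge_zero Suc.prems(2)] .
    show ?thesis
    proof (cases "integrable \<pi> (\<lambda>x. f (proj_act g x))")
      case True
      have "\<bar>\<integral>x. f (proj_act g x) \<partial>\<pi>\<bar> \<le> (\<integral>x. \<bar>f (proj_act g x)\<bar> \<partial>\<pi>)"
        by (rule integral_abs_bound)
      also have "\<dots> \<le> B"
        using True Suc.prems(2) by (intro \<pi>.integral_le_const) auto
      finally show ?thesis .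
    next
      case False
      then show ?thesis
        using \<open>0 \<le> B\<close> by (simp add: not_integrable_integral_eq)
    qed
  qed
  have "(\<integral>x. f x \<partial>act_convolution (convolution_power farey_group \<mu> (Suc n)) \<pi>) =
      (\<integral>g. \<integral>x. f (proj_act g x) \<partial>\<pi> \<partial>convolution_power farey_group \<mu> (Suc n))"
    using fm Suc.prems(2) by (rule integral_act_convolution)
  also have "\<dots> = (\<integral>g. \<integral>h. \<integral>x. f (proj_act (g \<otimes>\<^bsub>farey_group\<^esub> h) x) \<partial>\<pi> \<partial>?\<nu> \<partial>\<mu>)"
    unfolding convolution_power.simps group_convolution_def
    using \<mu> convolution_power_family countable_farey_group bound
    by (intro integral_family[where C = ?G and B = B])
      (auto intro!: measurable_discrete[where C = ?G] simp: farey_group_mult_closed)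
  also have "\<dots> = (\<Sum>A\<in>{farey_a, farey_b, farey_c}.
      \<integral>h. \<integral>x. f (proj_act (psl_class A \<otimes>\<^bsub>farey_group\<^esub> h) x) \<partial>\<pi> \<partial>?\<nu>) / 3"
    by (simp add: integral_step farey_mat2 mat2_eq_iff)
  also have "(\<Sum>A\<in>{farey_a, farey_b, farey_c}.
        \<integral>h. \<integral>x. f (proj_act (psl_class A \<otimes>\<^bsub>farey_group\<^esub> h) x) \<partial>\<pi> \<partial>?\<nu>) =
      (\<Sum>A\<in>{farey_a, farey_b, farey_c}. \<integral>x. f (act A x) \<partial>act_convolution ?\<nu> \<pi>)"
  proof (rule sum.cong[OF refl])
    fix A assume A: "A \<in> {farey_a, farey_b, farey_c}"
    then have "psl_class A \<in> ?G" "det A = 1"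
      using farey_group_generators det_farey by auto
    have "space ?\<nu> = ?G"
      using sets_eq_imp_space_eq[of ?\<nu> "count_space ?G"] convolution_power_family by simp
    then have "(\<integral>h. \<integral>x. f (proj_act (psl_class A \<otimes>\<^bsub>farey_group\<^esub> h) x) \<partial>\<pi> \<partial>?\<nu>) =
        (\<integral>h. \<integral>x. f (act A (proj_act h x)) \<partial>\<pi> \<partial>?\<nu>)"
      using \<open>psl_class A \<in> ?G\<close>
      by (intro Bochner_Integration.integral_cong) (simp_all add: proj_act_mult act_def)
    also have "\<dots> = (\<integral>x. f (act A x) \<partial>act_convolution ?\<nu> \<pi>)"
      using Suc.prems(2) measurable_compose[OF borel_measurable_continuous_onI[OF continuous_act[OF \<open>det A = 1\<close>]] fm]
      by (intro integral_act_convolution[symmetric]) auto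
    finally show "(\<integral>h. \<integral>x. f (proj_act (psl_class A \<otimes>\<^bsub>farey_group\<^esub> h) x) \<partial>\<pi> \<partial>?\<nu>) =
        (\<integral>x. f (act A x) \<partial>act_convolution ?\<nu> \<pi>)" .
  qed
  also have "\<dots> / 3 = (\<integral>x. walk_average f x \<partial>act_convolution ?\<nu> \<pi>)"
  proof -
    interpret C: prob_space "act_convolution ?\<nu> \<pi>"
      by (rule prob_space_act_convolution)
    have "integrable (act_convolution ?\<nu> \<pi>) (\<lambda>x. f (act A x))" if "det A = 1" for A
      using Suc.prems(2) measurable_compose[OF borel_measurable_continuous_onI[OF continuous_act[OF that]] fm]
      by (intro C.integrable_const_bound[where B = B]) (auto simp: sets_act_convolution cong: measurable_cong_sets)
    moreover have "farey_a \<noteq> farey_b" "farey_a \<noteq> farey_c" "farey_b \<noteq> farey_c"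
      by (simp_all add: farey_mat2 mat2_eq_iff)
    ultimately show ?thesis
      by (simp add: walk_average_def det_farey)
  qed
  also have "\<dots> = (\<integral>x. (walk_average ^^ n) (walk_average f) x \<partial>\<pi>)"
    using Suc.prems by (intro Suc.IH continuous_walk_average walk_average_bounded)
  finally show ?case
    by (simp add: funpow_swap1)
qed

end

text \<open>Both integrals are means of \<open>f\<close> and lie within \<open>D\<close> of every value of \<open>f\<close>.\<close>

lemma integral_diff_le_oscillation:
  fixes f :: "'a \<Rightarrow> real"
  assumes "prob_space M" "prob_space N" "integrable M f" "integrable N f"
    and osc: "\<And>x y. \<bar>f x - f y\<bar> \<le> D"
  shows "\<bar>(\<integral>x. f x \<partial>M) - (\<integral>x. f x \<partial>N)\<bar> \<le> D"
proof -
  interpret M: prob_space M by fact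
  interpret N: prob_space N by fact
  have "f x - D \<le> (\<integral>y. f y \<partial>N)" "(\<integral>y. f y \<partial>N) \<le> f x + D" for x
    using osc[of x] assms(4)
    by (intro N.integral_ge_const N.integral_le_const; force simp: abs_le_iff algebra_simps)+
  then have "f x \<le> (\<integral>y. f y \<partial>N) + D" "(\<integral>y. f y \<partial>N) - D \<le> f x" for x
    by (simp_all add: algebra_simps)
  then have "(\<integral>x. f x \<partial>M) \<le> (\<integral>y. f y \<partial>N) + D" "(\<integral>y. f y \<partial>N) - D \<le> (\<integral>x. f x \<partial>M)"
    using assms(3) by (intro M.integral_le_const M.integral_ge_const; simp)+
  then show ?thesis
    by (simp add: abs_le_iff)
qed

lemma limitin_weak_starI:
  assumes "prob_space M" "sets M = sets borel" "\<And>n. prob_space (X n)" "\<And>n. sets (X n) = sets borel"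
    and lim: "\<And>f :: 'a::topological_space \<Rightarrow> real. continuous_on UNIV f \<Longrightarrow> (\<lambda>n. \<integral>x. f x \<partial>X n) \<longlonglongrightarrow> (\<integral>x. f x \<partial>M)"
  shows "limitin weak_star_topology X M sequentially"
proof -
  let ?C = "{f :: 'a \<Rightarrow> real. continuous_on UNIV f}"
  let ?P = "{M :: 'a measure. prob_space M \<and> sets M = sets borel}"
  let ?I = "\<lambda>M :: 'a measure. \<lambda>f\<in>?C. \<integral>x. f x \<partial>M"
  have "limitin (powertop_real ?C) (\<lambda>n. ?I (X n)) (?I M) sequentially"
    using lim by (simp add: limitin_componentwise)
  note conv = this
  show ?thesis
    unfolding weak_star_topology_def limitin_def
  proof (intro conjI allI impI)
    show "M \<in> topspace (pullback_topology ?P ?I (powertop_real ?C))"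
      using assms(1,2) limitin_topspace[OF conv] by (simp add: topspace_pullback_topology)
    fix U
    assume U: "openin (pullback_topology ?P ?I (powertop_real ?C)) U \<and> M \<in> U"
    then obtain V where V: "openin (powertop_real ?C) V" "U = ?I -` V \<inter> ?P"
      by (auto simp: openin_pullback_topology)
    then have "eventually (\<lambda>n. ?I (X n) \<in> V) sequentially"
      using U by (intro limitinD[OF conv]) auto
    then show "eventually (\<lambda>n. X n \<in> U) sequentially"
      by eventually_elim (use assms(3,4) V(2) in auto)
  qed
qed

theorem theorem2p3:
  fixes \<mu> :: "(real^2^2) set measure" and \<pi> :: "proj_line measure"
  assumes "prob_space \<mu>" and "sets \<mu> = Pow (carrier farey_group)"
    and "measure \<mu> {psl_class farey_a} = 1/3"
    and "measure \<mu> {psl_class farey_b} = 1/3"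
    and "measure \<mu> {psl_class farey_c} = 1/3"
    and "prob_space \<pi>" and "sets \<pi> = sets borel"
  shows "limitin weak_star_topology
           (\<lambda>n. act_convolution (convolution_power farey_group \<mu> n) \<pi>)
           ext_minkowski_measure sequentially"
proof (rule limitin_weak_starI)
  fix f :: "proj_line \<Rightarrow> real"
  assume f: "continuous_on UNIV f"
  obtain B where B: "\<And>x. \<bar>f x\<bar> \<le> B"
    using proj_line_function_bounded_uniform(1)[OF f] by blast
  interpret N: prob_space ext_minkowski_measure
    by (rule prob_space_ext_minkowski)
  interpret \<pi>: prob_space \<pi>
    by fact
  have iter: "continuous_on UNIV ((walk_average ^^ n) f)" "\<bar>(walk_average ^^ n) f x\<bar> \<le> B" for n x
    by (induction n arbitrary: x) (simp_all add: f B continuous_walk_average walk_average_bounded)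
  have stationary: "(\<integral>x. (walk_average ^^ n) f x \<partial>ext_minkowski_measure) = (\<integral>x. f x \<partial>ext_minkowski_measure)" for n
    by (induction n) (simp_all add: integral_walk_average[OF iter])
  have int: "integrable \<pi> ((walk_average ^^ n) f)" "integrable ext_minkowski_measure ((walk_average ^^ n) f)" for n
    using iter(2)[of n] borel_measurable_continuous_onI[OF iter(1)[of n]] assms(7) sets_ext_minkowski
    by (intro \<pi>.integrable_const_bound[where B = B] N.integrable_const_bound[where B = B];
        simp cong: measurable_cong_sets)+
  show "(\<lambda>n. \<integral>x. f x \<partial>act_convolution (convolution_power farey_group \<mu> n) \<pi>)
      \<longlonglongrightarrow> (\<integral>x. f x \<partial>ext_minkowski_measure)"
  proof (rule LIMSEQ_I)
    fix e :: real assume "0 < e"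
    then obtain C where C: "0 \<le> C" "arc_lipschitz (e / 2) C f"
      using continuous_arc_lipschitz[OF f, of "e / 2"] by auto
    have osc: "\<bar>(walk_average ^^ n) f x - (walk_average ^^ n) f y\<bar> \<le> e / 2 + (17/18) ^ n * C" for n x y
      using arc_lipschitz_iterate[OF C(2,1), of n] unfolding arc_lipschitz_def
      by (metis mult.right_neutral power_0 same_arc.simps(1))
    have "(\<lambda>n. (17/18) ^ n * C) \<longlonglongrightarrow> 0 * C"
      by (intro tendsto_mult tendsto_const LIMSEQ_realpow_zero) simp_all
    then have "eventually (\<lambda>n. (17/18) ^ n * C < e / 2) sequentially"
      using \<open>0 < e\<close> by (intro order_tendstoD(2)[where y = 0]) simp_all
    then obtain N where N: "\<And>n. n \<ge> N \<Longrightarrow> (17/18) ^ n * C < e / 2"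
      by (auto simp: eventually_sequentially)
    show "\<exists>N. \<forall>n\<ge>N. norm ((\<integral>x. f x \<partial>act_convolution (convolution_power farey_group \<mu> n) \<pi>) -
        (\<integral>x. f x \<partial>ext_minkowski_measure)) < e"
    proof (intro exI[of _ N] allI impI)
      fix n assume "N \<le> n"
      have "norm ((\<integral>x. f x \<partial>act_convolution (convolution_power farey_group \<mu> n) \<pi>) -
          (\<integral>x. f x \<partial>ext_minkowski_measure)) =
          \<bar>(\<integral>x. (walk_average ^^ n) f x \<partial>\<pi>) - (\<integral>x. (walk_average ^^ n) f x \<partial>ext_minkowski_measure)\<bar>"
        unfolding stationary using integral_act_convolution_power[OF assms f B] by simp
      also have "\<dots> \<le> e / 2 + (17/18) ^ n * C"
        using assms(6) prob_space_ext_minkowski int osc by (rule integral_diff_le_oscillation)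
      also have "\<dots> < e"
        using N[OF \<open>N \<le> n\<close>] by simp
      finally show "norm ((\<integral>x. f x \<partial>act_convolution (convolution_power farey_group \<mu> n) \<pi>) -
          (\<integral>x. f x \<partial>ext_minkowski_measure)) < e" .
    qed
  qed
qed (use assms prob_space_ext_minkowski sets_ext_minkowski prob_space_act_convolution sets_act_convolution in auto)

end
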